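(* Let $D$ be an associative division ring with center $C$, $\sigma$ a non-trivial automorphism of $D$, $F=C\cap\mathrm{Fix}(\sigma)$, and let $f(t)=t^m-\sum_{i=0}^{m-1}a_it^i\in R=D[t;\sigma]$ with $m\ge2$. For $\tau\in\mathrm{Aut}_F(D)$ and $k\in C^\times$ define $$H_{\tau,k}:S_f\to S_f,\qquad \sum_{i=0}^{m-1}x_it^i\mapsto\tau(x_0)+\sum_{i=1}^{m-1}\tau(x_i)\Big(\prod_{l=0}^{i-1}\sigma^l(k)\Big)t^i .$$ (i) For every $k\in C^\times$ such that $a_i=\big(\prod_{l=i}^{m-1}\sigma^l(k)\big)a_i$ for all $i\in\{0,\dots,m-1\}$, the map $H_{\mathrm{id},k}$ is an $F$-automorphism of $S_f$. Furthermore, the set of all $H_{\mathrm{id},k}$ with $k\in C^\times$ satisfying this condition is a subgroup of $\mathrm{Aut}_F(S_f)$. (ii) For every $\tau\in\mathrm{Aut}_F(D)$ and $k\in C^\times$ such that $\tau$ commutes with $\sigma$ and $$\tau(a_i)=\Big(\prod_{l=i}^{m-1}\sigma^l(k)\Big)a_i\quad\text{for all } i\in\{0,\dots,m-1\},$$ the map $H_{\tau,k}$ is an $F$-automorphism of $S_f$. Moreover, the set of all $H_{\tau,k}$ with $\tau\in\mathrm{Aut}_F(D)$, $\tau\circ\sigma=\sigma\circ\tau$ and $k\in C^\times$ satisfying the displayed condition is a subgroup of $\mathrm{Aut}_F(S_f)$. (iii) Suppose $f(t)$ is not right invariant, $\sigma$ commutes with all $F$-automorphisms of $D$, and $\sigma|_C$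 has order at least $m-1$ (infinite order allowed). Then a map $H:S_f\to S_f$ is an $F$-automorphism of $S_f$ if and only if $H=H_{\tau,k}$ for some $\tau\in\mathrm{Aut}_F(D)$ and $k\in C^\times$ such that $\tau(a_i)=\big(\prod_{l=i}^{m-1}\sigma^l(k)\big)a_i$ for all $i\in\{0,\dots,m-1\}$.
   Context: $R=D[t;\sigma]$ is the twisted polynomial ring of left polynomials $\sum a_it^i$, $a_i\in D$, with $ta=\sigma(a)t$. $\mathrm{Fix}(\sigma)=\{d\in D:\sigma(d)=d\}$. There is a right division algorithm in $R$: for $f\ne0$ and $g$ in $R$ there are unique $q,r\in R$ with $g=qf+r$, $\deg(r)<\deg(f)$; write $g\bmod_r f:=r$. Petit algebra: for $f\in R$ of degree $m\geq 2$, $S_f=(R_m,\circ)$ where $R_m=\{g\in R:\deg(g)<m\}$ and $g\circ h=gh\bmod_r f$; it is a unital, in general nonassociative, algebra over $F$. $f$ is right invariant if $Rf$ is a two-sided ideal of $R$. $\mathrm{Aut}_F(D)$ is the group of ring automorphisms of $D$ fixing $F$ pointwise; $\mathrm{Aut}_F(S_f)$ is the group of bijective $F$-linear multiplicative maps $S_f\to S_f$. *)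

theory Defs
  imports
    "HOL-Algebra.Multiplicative_Group"
    "HOL-Algebra.Bij"
    "HOL-Algebra.Ideal"
    "HOL-Algebra.Module"
    "HOL-Computational_Algebra.Polynomial"
begin

hide_const (open) UnivPoly.coeff UnivPoly.monom UnivPoly.deg Polynomial.smult Polynomial.order Multiset.mult

section \<open>Division rings and their automorphisms\<close>

definition center :: "'a::division_ring set"
  where "center = {c. \<forall>d. c * d = d * c}"

definition Fix :: "('a \<Rightarrow> 'a) \<Rightarrow> 'a set"
  where "Fix \<sigma> = {d. \<sigma> d = d}"

definition ring_aut :: "('a::division_ring \<Rightarrow> 'a) \<Rightarrow> bool"
  where "ring_aut \<tau> \<longleftrightarrow> bij \<tau> \<and> \<tau> 1 = 1 \<and>
    (\<forall>x y. \<tau> (x + y) = \<tau> x + \<tau> y) \<and> (\<forall>x y. \<tau> (x * y) = \<tau> x * \<tau> y)"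

definition Aut_over :: "'a::division_ring set \<Rightarrow> ('a \<Rightarrow> 'a) set"
  where "Aut_over F = {\<tau>. ring_aut \<tau> \<and> (\<forall>c\<in>F. \<tau> c = c)}"

lemma ring_aut_funpow:
  assumes "ring_aut \<sigma>"
  shows "ring_aut (\<sigma> ^^ n)"
proof (induction n)
  case (Suc n)
  then show ?case using assms bij_comp[of "\<sigma> ^^ n" \<sigma>] by (simp add: ring_aut_def o_def)
qed (simp add: ring_aut_def bij_id[unfolded id_def])

lemma ring_aut_0: "ring_aut \<tau> \<Longrightarrow> \<tau> 0 = 0"
  unfolding ring_aut_def by (metis add_cancel_right_right)

lemma ring_aut_eq_0: "ring_aut \<tau> \<Longrightarrow> \<tau> x = 0 \<longleftrightarrow> x = 0"
  by (metis ring_aut_0 ring_aut_def bij_is_inj inj_eq)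

lemma ring_aut_sum:
  assumes "ring_aut \<tau>"
  shows "\<tau> (sum g A) = (\<Sum>x\<in>A. \<tau> (g x))"
  using assms by (induction A rule: infinite_finite_induct) (auto simp: ring_aut_0 ring_aut_def)

text \<open>
  The order of the restriction of \<open>\<sigma>\<close> to \<open>C\<close>, computed in the group of permutations
  of \<open>C\<close>. As always with \<^const>\<open>group.ord\<close>, the value 0 stands for infinite order.
\<close>

definition restricted_order :: "('a \<Rightarrow> 'a) \<Rightarrow> 'a set \<Rightarrow> nat"
  where "restricted_order \<sigma> C = group.ord (BijGroup C) (restrict \<sigma> C)"

section \<open>The twisted polynomial ring\<close>

text \<open>
  The type \<^typ>\<open>'a poly\<close> serves only as the additive group of left polynomials
  (coefficients on the left of the powers of \<open>t\<close>); the product is the one determined by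
  \<open>t a = \<sigma>(a) t\<close>, that is \<open>(a t\<^sup>i) (b t\<^sup>j) = a \<sigma>\<^sup>i(b) t\<^sup>i\<^sup>+\<^sup>j\<close>. The commutative product that the
  library defines on \<^typ>\<open>'a poly\<close> is not available over a division ring.
\<close>

definition skew_mult :: "('a::division_ring \<Rightarrow> 'a) \<Rightarrow> 'a poly \<Rightarrow> 'a poly \<Rightarrow> 'a poly"
  where "skew_mult \<sigma> p q =
    (\<Sum>i\<le>degree p. \<Sum>j\<le>degree q. monom (coeff p i * (\<sigma> ^^ i) (coeff q j)) (i + j))"

definition skew_poly_ring :: "('a::division_ring \<Rightarrow> 'a) \<Rightarrow> 'a poly ring"
  where "skew_poly_ring \<sigma> =
    \<lparr>carrier = UNIV, mult = skew_mult \<sigma>, one = monom 1 0, zero = 0, add = (+)\<rparr>"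

lemma coeff_skew_mult:
  assumes "ring_aut \<sigma>"
  shows "coeff (skew_mult \<sigma> p q) n = (\<Sum>i=0..n. coeff p i * (\<sigma> ^^ i) (coeff q (n - i)))"
proof -
  have z: "(\<sigma> ^^ i) 0 = 0" for i
    using ring_aut_0[OF ring_aut_funpow[OF assms]] .
  have "coeff (skew_mult \<sigma> p q) n
      = (\<Sum>i\<le>degree p. \<Sum>j\<le>degree q. if j = n - i \<and> i \<le> n then coeff p i * (\<sigma> ^^ i) (coeff q j) else 0)"
    unfolding skew_mult_def coeff_sum coeff_monom
    by (intro sum.cong refl) auto
  also have "\<dots> = (\<Sum>i\<le>degree p. if i \<le> n then coeff p i * (\<sigma> ^^ i) (coeff q (n - i)) else 0)"
  proof (intro sum.cong refl)
    fix i
    show "(\<Sum>j\<le>degree q. if j = n - i \<and> i \<le> n then coeff p i * (\<sigma> ^^ i) (coeff q j) else 0)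
       = (if i \<le> n then coeff p i * (\<sigma> ^^ i) (coeff q (n - i)) else 0)"
      by (cases "i \<le> n") (auto simp: z coeff_eq_0)
  qed
  also have "\<dots> = (\<Sum>i\<in>{..degree p} \<inter> {0..n}. coeff p i * (\<sigma> ^^ i) (coeff q (n - i)))"
    by (subst sum.inter_restrict) (auto intro: sum.cong)
  also have "\<dots> = (\<Sum>i=0..n. coeff p i * (\<sigma> ^^ i) (coeff q (n - i)))"
    by (rule sum.mono_neutral_left) (auto simp: coeff_eq_0 not_le)
  finally show ?thesis .
qed

lemma skew_mult_assoc:
  assumes "ring_aut \<sigma>"
  shows "skew_mult \<sigma> (skew_mult \<sigma> p q) r = skew_mult \<sigma> p (skew_mult \<sigma> q r)"
proof (rule poly_eqI)
  fix n
  have h: "ring_aut (\<sigma> ^^ i)" for i by (rule ring_aut_funpow[OF assms])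
  let ?g = "\<lambda>i j. coeff p i * (\<sigma> ^^ i) (coeff q j) * (\<sigma> ^^ (i + j)) (coeff r (n - (i + j)))"
  have "coeff (skew_mult \<sigma> (skew_mult \<sigma> p q) r) n = (\<Sum>s\<le>n. \<Sum>i\<le>s. ?g i (s - i))"
    by (simp add: coeff_skew_mult[OF assms] sum_distrib_right atMost_atLeast0)
  also have "\<dots> = (\<Sum>(i,j)\<in>{(i,j). i + j \<le> n}. ?g i j)"
    by (rule sum.triangle_reindex_eq[symmetric])
  also have "{(i,j). i + j \<le> n} = (SIGMA i:{..n}. {..n - i})"
    by auto
  also have "(\<Sum>(i,j)\<in>\<dots>. ?g i j) = (\<Sum>i\<le>n. \<Sum>j\<le>n - i. ?g i j)"
    by (simp add: sum.Sigma)
  also have "\<dots> = coeff (skew_mult \<sigma> p (skew_mult \<sigma> q r)) n"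
    using h by (auto simp: coeff_skew_mult[OF assms] atMost_atLeast0 ring_aut_sum[OF h] sum_distrib_left
      funpow_add mult.assoc ring_aut_def intro!: sum.cong)
  finally show "coeff (skew_mult \<sigma> (skew_mult \<sigma> p q) r) n = coeff (skew_mult \<sigma> p (skew_mult \<sigma> q r)) n" .
qed

lemma ring_skew_poly_ring:
  assumes "ring_aut \<sigma>"
  shows "ring (skew_poly_ring \<sigma>)"
proof -
  have h: "ring_aut (\<sigma> ^^ i)" for i by (rule ring_aut_funpow[OF assms])
  have hp: "(\<sigma> ^^ i) (x + y) = (\<sigma> ^^ i) x + (\<sigma> ^^ i) y" for i x y
    using h by (auto simp: ring_aut_def)
  have h1: "(\<sigma> ^^ i) 1 = 1" for i
    using h by (auto simp: ring_aut_def)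
  have h0: "(\<sigma> ^^ i) 0 = 0" for i
    using ring_aut_0[OF h] .
  show ?thesis
  proof (rule ringI)
    show "abelian_group (skew_poly_ring \<sigma>)"
      by (rule abelian_groupI) (auto simp: skew_poly_ring_def algebra_simps intro: exI[of _ "- _"] right_minus)
    show "Group.monoid (skew_poly_ring \<sigma>)"
    proof
      fix p q r :: "'a poly"
      show "p \<otimes>\<^bsub>skew_poly_ring \<sigma>\<^esub> q \<otimes>\<^bsub>skew_poly_ring \<sigma>\<^esub> r =
        p \<otimes>\<^bsub>skew_poly_ring \<sigma>\<^esub> (q \<otimes>\<^bsub>skew_poly_ring \<sigma>\<^esub> r)"
        by (simp add: skew_poly_ring_def skew_mult_assoc[OF assms])
      have "(\<Sum>i = 0..n. coeff (monom 1 0) i * (\<sigma> ^^ i) (coeff p (n - i))) = coeff p n" for n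
        by (subst sum.remove[of _ 0]) (auto simp: intro!: sum.neutral)
      then show "\<one>\<^bsub>skew_poly_ring \<sigma>\<^esub> \<otimes>\<^bsub>skew_poly_ring \<sigma>\<^esub> p = p"
        by (auto simp: skew_poly_ring_def coeff_skew_mult[OF assms] intro!: poly_eqI)
      have "(\<Sum>i = 0..n. coeff p i * (\<sigma> ^^ i) (coeff (monom 1 0) (n - i))) = coeff p n" for n
        by (subst sum.remove[of _ n]) (auto simp: h0 h1 intro!: sum.neutral)
      then show "p \<otimes>\<^bsub>skew_poly_ring \<sigma>\<^esub> \<one>\<^bsub>skew_poly_ring \<sigma>\<^esub> = p"
        by (auto simp: skew_poly_ring_def coeff_skew_mult[OF assms] intro!: poly_eqI)
    qed (auto simp: skew_poly_ring_def)
  qed (auto simp: skew_poly_ring_def coeff_skew_mult[OF assms] hp algebra_simps sum.distrib intro!: poly_eqI)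
qed

lemma skew_mult_t:
  assumes "ring_aut \<sigma>"
  shows "skew_mult \<sigma> (monom 1 1) (monom a 0) = skew_mult \<sigma> (monom (\<sigma> a) 0) (monom 1 1)"
proof -
  have "skew_mult \<sigma> (monom b i) (monom c j) = monom (b * (\<sigma> ^^ i) c) (i + j)" for b c i j
  proof (rule poly_eqI)
    fix n
    have "coeff (skew_mult \<sigma> (monom b i) (monom c j)) n
        = (\<Sum>l=0..n. if l = i then b * (\<sigma> ^^ i) (coeff (monom c j) (n - i)) else 0)"
      unfolding coeff_skew_mult[OF assms] by (intro sum.cong) auto
    also have "\<dots> = coeff (monom (b * (\<sigma> ^^ i) c) (i + j)) n"
      using ring_aut_0[OF ring_aut_funpow[OF assms]] by auto
    finally show "coeff (skew_mult \<sigma> (monom b i) (monom c j)) n = coeff (monom (b * (\<sigma> ^^ i) c) (i + j)) n" .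
  qed
  then show ?thesis by simp
qed

definition right_invariant :: "('a::division_ring \<Rightarrow> 'a) \<Rightarrow> 'a poly \<Rightarrow> bool"
  where "right_invariant \<sigma> f \<longleftrightarrow>
    ideal (PIdl\<^bsub>skew_poly_ring \<sigma>\<^esub> f) (skew_poly_ring \<sigma>)"

text \<open>
  Remainder of right division by \<open>f\<close>. The disjunct \<open>r = 0\<close> accounts for the convention
  that the zero polynomial has degree \<open>-\<infinity>\<close>, whereas \<^term>\<open>degree 0 = 0\<close> in the library.
\<close>

definition rmod :: "('a::division_ring \<Rightarrow> 'a) \<Rightarrow> 'a poly \<Rightarrow> 'a poly \<Rightarrow> 'a poly"
  where "rmod \<sigma> g f =
    (THE r. \<exists>q. g = skew_mult \<sigma> q f + r \<and> (r = 0 \<or> degree r < degree f))"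

lemma rmod_unique_existence:
  assumes "ring_aut \<sigma>" and "f \<noteq> 0"
  shows "\<exists>!r. \<exists>q. g = skew_mult \<sigma> q f + r \<and> (r = 0 \<or> degree r < degree f)"
proof -
  have h: "ring_aut (\<sigma> ^^ i)" for i by (rule ring_aut_funpow[OF assms(1)])
  have h0: "(\<sigma> ^^ i) 0 = 0" for i using ring_aut_0[OF h] .
  have R: "ring (skew_poly_ring \<sigma>)" by (rule ring_skew_poly_ring[OF assms(1)])
  have dl: "skew_mult \<sigma> (p + q) f = skew_mult \<sigma> p f + skew_mult \<sigma> q f" for p q
    using ring.ring_simprules(13)[OF R, of p q f] by (simp add: skew_poly_ring_def)
  have dm: "skew_mult \<sigma> (p - q) f = skew_mult \<sigma> p f - skew_mult \<sigma> q f" for p q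
    using dl[of "p - q" q] by (simp add: algebra_simps)
  have top: "coeff (skew_mult \<sigma> q f) (degree q + degree f)
      = coeff q (degree q) * (\<sigma> ^^ degree q) (coeff f (degree f))" for q
    unfolding coeff_skew_mult[OF assms(1)]
  proof (subst sum.remove[of _ "degree q"])
    show "coeff q (degree q) * (\<sigma> ^^ degree q) (coeff f (degree q + degree f - degree q)) +
      (\<Sum>i\<in>{0..degree q + degree f} - {degree q}.
         coeff q i * (\<sigma> ^^ i) (coeff f (degree q + degree f - i))) =
      coeff q (degree q) * (\<sigma> ^^ degree q) (coeff f (degree f))"
    proof -
      have "coeff q i * (\<sigma> ^^ i) (coeff f (degree q + degree f - i)) = 0"
        if "i \<noteq> degree q" for i
      proof (cases "i < degree q")
        case True
        then have "degree f < degree q + degree f - i" by simp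
        then show ?thesis by (simp add: coeff_eq_0 h0)
      next
        case False
        then show ?thesis using that by (simp add: coeff_eq_0)
      qed
      then show ?thesis by (simp add: sum.neutral)
    qed
  qed auto
  have le: "degree (skew_mult \<sigma> q f) \<le> degree q + degree f" for q
  proof (rule degree_le, intro allI impI)
    fix n assume n: "degree q + degree f < n"
    have "coeff q i * (\<sigma> ^^ i) (coeff f (n - i)) = 0" for i
    proof (cases "degree q < i")
      case False
      then have "degree f < n - i" using n by simp
      then show ?thesis by (simp add: coeff_eq_0 h0)
    qed (simp add: coeff_eq_0)
    then show "coeff (skew_mult \<sigma> q f) n = 0"
      by (simp add: coeff_skew_mult[OF assms(1)] sum.neutral)
  qed
  have nz: "coeff (skew_mult \<sigma> q f) (degree q + degree f) \<noteq> 0" if "q \<noteq> 0" for q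
    using that assms(2) ring_aut_eq_0[OF h] by (simp add: top)
  have ex: "\<exists>r q. g = skew_mult \<sigma> q f + r \<and> (r = 0 \<or> degree r < degree f)"
  proof (induction "degree g" arbitrary: g rule: less_induct)
    case less
    show ?case
    proof (cases "g = 0 \<or> degree g < degree f")
      case True
      have "skew_mult \<sigma> 0 f = 0" using dm[of 0 0] by simp
      then show ?thesis using True by (metis add_0)
    next
      case False
      let ?n = "degree g - degree f"
      define c where "c = coeff g (degree g) * inverse ((\<sigma> ^^ ?n) (coeff f (degree f)))"
      define q where "q = monom c ?n"
      have nzf: "(\<sigma> ^^ ?n) (coeff f (degree f)) \<noteq> 0"
        using assms(2) ring_aut_eq_0[OF h] by simp
      have "c \<noteq> 0" using False nzf by (simp add: c_def)
      then have dq: "degree q = ?n" "coeff q (degree q) = c" by (simp_all add: q_def degree_monom_eq)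
      have eq: "degree q + degree f = degree g" using False dq by simp
      have cz: "coeff (g - skew_mult \<sigma> q f) (degree g) = 0"
      proof -
        have "coeff (skew_mult \<sigma> q f) (degree g) = c * (\<sigma> ^^ ?n) (coeff f (degree f))"
          using top[of q] eq dq by metis
        then show ?thesis using nzf by (simp add: c_def mult.assoc)
      qed
      have dg: "degree (g - skew_mult \<sigma> q f) \<le> degree g"
        using le[of q] eq by (simp add: degree_diff_le)
      show ?thesis
      proof (cases "degree g = 0")
        case True
        then have "g - skew_mult \<sigma> q f = 0"
          using dg cz by (metis le_zero_eq leading_coeff_0_iff)
        then show ?thesis by (metis add.right_neutral right_minus_eq)
      next
        case dpos: False
        then have "degree (g - skew_mult \<sigma> q f) < degree g"
          using dg cz by (metis le_neq_implies_less degree_0 leading_coeff_0_iff neq0_conv)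
        from less[OF this] obtain r q' where
          "g - skew_mult \<sigma> q f = skew_mult \<sigma> q' f + r" "r = 0 \<or> degree r < degree f" by blast
        moreover from this(1) have "g = skew_mult \<sigma> (q' + q) f + r"
          by (simp add: dl algebra_simps)
        ultimately show ?thesis by blast
      qed
    qed
  qed
  have un: "r = r'"
    if "g = skew_mult \<sigma> q f + r" "r = 0 \<or> degree r < degree f"
      "g = skew_mult \<sigma> q' f + r'" "r' = 0 \<or> degree r' < degree f" for q q' r r'
  proof (rule ccontr)
    assume ne: "r \<noteq> r'"
    have e: "skew_mult \<sigma> (q - q') f = r' - r"
      using that(1,3) by (simp add: dm algebra_simps)
    then have q: "q - q' \<noteq> 0" using ne dm[of 0 0] by auto
    have "degree (r' - r) < degree f"
      using that(2,4) ne by (auto intro: degree_diff_less)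
    then have "coeff (skew_mult \<sigma> (q - q') f) (degree (q - q') + degree f) = 0"
      unfolding e by (intro coeff_eq_0) simp
    then show False using nz[OF q] by simp
  qed
  show ?thesis using ex un by blast
qed

section \<open>Petit algebras and automorphisms of nonassociative algebras\<close>

text \<open>
  The library record of modules provides all operations of an algebra; the
  associativity and commutativity axioms of the locales on it are not assumed.
\<close>

definition petit_algebra :: "('a::division_ring \<Rightarrow> 'a) \<Rightarrow> 'a poly \<Rightarrow> ('a, 'a poly) module"
  where "petit_algebra \<sigma> f =
    \<lparr>carrier = {g. degree g < degree f},
     mult = (\<lambda>g h. rmod \<sigma> (skew_mult \<sigma> g h) f),
     one = monom 1 0,
     zero = 0,
     add = (+),
     smult = (\<lambda>c g. map_poly (\<lambda>x. c * x) g)\<rparr>"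

text \<open>
  As in \<^const>\<open>BijGroup\<close>, maps are extensional functions: outside the carrier
  they take the value \<^const>\<open>undefined\<close>.
\<close>

definition algebra_auts :: "'k set \<Rightarrow> ('k, 'b, 'm) module_scheme \<Rightarrow> ('b \<Rightarrow> 'b) set"
  where "algebra_auts F A = {H \<in> Bij (carrier A).
    (\<forall>x\<in>carrier A. \<forall>y\<in>carrier A. H (x \<oplus>\<^bsub>A\<^esub> y) = H x \<oplus>\<^bsub>A\<^esub> H y) \<and>
    (\<forall>c\<in>F. \<forall>x\<in>carrier A. H (c \<odot>\<^bsub>A\<^esub> x) = c \<odot>\<^bsub>A\<^esub> H x) \<and>
    (\<forall>x\<in>carrier A. \<forall>y\<in>carrier A. H (x \<otimes>\<^bsub>A\<^esub> y) = H x \<otimes>\<^bsub>A\<^esub> H y)}"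

definition algebra_aut_group :: "'k set \<Rightarrow> ('k, 'b, 'm) module_scheme \<Rightarrow> ('b \<Rightarrow> 'b) monoid"
  where "algebra_aut_group F A = (BijGroup (carrier A)) \<lparr>carrier := algebra_auts F A\<rparr>"

lemma group_algebra_aut_group:
  assumes "\<And>x y. x \<in> carrier A \<Longrightarrow> y \<in> carrier A \<Longrightarrow> x \<oplus>\<^bsub>A\<^esub> y \<in> carrier A"
    and "\<And>x y. x \<in> carrier A \<Longrightarrow> y \<in> carrier A \<Longrightarrow> x \<otimes>\<^bsub>A\<^esub> y \<in> carrier A"
    and "\<And>c x. c \<in> F \<Longrightarrow> x \<in> carrier A \<Longrightarrow> c \<odot>\<^bsub>A\<^esub> x \<in> carrier A"
  shows "group (algebra_aut_group F A)"
proof -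
  let ?S = "carrier A"
  interpret B: group "BijGroup ?S" by (rule group_BijGroup)
  have "subgroup (algebra_auts F A) (BijGroup ?S)"
  proof (rule B.subgroupI)
    show "algebra_auts F A \<subseteq> carrier (BijGroup ?S)"
      by (auto simp: algebra_auts_def BijGroup_def)
    have "(\<lambda>x\<in>?S. x) \<in> algebra_auts F A"
      using assms by (auto simp: algebra_auts_def id_Bij)
    then show "algebra_auts F A \<noteq> {}" by blast
  next
    fix H assume H: "H \<in> algebra_auts F A"
    then have B: "H \<in> Bij ?S" by (simp add: algebra_auts_def)
    then have b: "bij_betw H ?S ?S" by (simp add: Bij_def)
    let ?I = "inv_into ?S H"
    have i1: "?I x \<in> ?S" "H (?I x) = x" if "x \<in> ?S" for x
      using that b by (auto simp: bij_betw_inv_into_right bij_betwE[OF bij_betw_inv_into])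
    have i2: "?I (H x) = x" if "x \<in> ?S" for x
      using that b by (simp add: bij_betw_inv_into_left)
    have hp: "H (x \<oplus>\<^bsub>A\<^esub> y) = H x \<oplus>\<^bsub>A\<^esub> H y" "H (x \<otimes>\<^bsub>A\<^esub> y) = H x \<otimes>\<^bsub>A\<^esub> H y"
      if "x \<in> ?S" "y \<in> ?S" for x y
      using that H by (auto simp: algebra_auts_def)
    have hs: "H (c \<odot>\<^bsub>A\<^esub> x) = c \<odot>\<^bsub>A\<^esub> H x" if "c \<in> F" "x \<in> ?S" for c x
      using that H by (auto simp: algebra_auts_def)
    have "?I (x \<oplus>\<^bsub>A\<^esub> y) = ?I x \<oplus>\<^bsub>A\<^esub> ?I y" "?I (x \<otimes>\<^bsub>A\<^esub> y) = ?I x \<otimes>\<^bsub>A\<^esub> ?I y"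
      if "x \<in> ?S" "y \<in> ?S" for x y
      using that i2[OF assms(1), of "?I x" "?I y"] i2[OF assms(2), of "?I x" "?I y"]
      by (simp_all add: hp i1)
    moreover have "?I (c \<odot>\<^bsub>A\<^esub> x) = c \<odot>\<^bsub>A\<^esub> ?I x" if "c \<in> F" "x \<in> ?S" for c x
      using that i2[OF assms(3), of c "?I x"] by (simp add: hs i1)
    ultimately have "restrict ?I ?S \<in> algebra_auts F A"
      using assms by (simp add: algebra_auts_def restrict_inv_into_Bij[OF B])
    then show "inv\<^bsub>BijGroup ?S\<^esub> H \<in> algebra_auts F A"
      by (simp add: inv_BijGroup[OF B])
  next
    fix H K assume H: "H \<in> algebra_auts F A" and K: "K \<in> algebra_auts F A"
    then have b: "H \<in> Bij ?S" "K \<in> Bij ?S" by (auto simp: algebra_auts_def)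
    have "K x \<in> ?S" if "x \<in> ?S" for x
      using that Bij_imp_funcset[OF b(2)] by auto
    then have "compose ?S H K \<in> algebra_auts F A"
      using assms H K by (auto simp: algebra_auts_def compose_Bij compose_eq)
    then show "H \<otimes>\<^bsub>BijGroup ?S\<^esub> K \<in> algebra_auts F A"
      using b by (simp add: BijGroup_def)
  qed
  then show ?thesis
    unfolding algebra_aut_group_def by (rule B.subgroup_imp_group)
qed

lemma group_petit_aut_group:
  assumes "ring_aut \<sigma>" and "degree f > 0"
  shows "group (algebra_aut_group F (petit_algebra \<sigma> f))"
proof (rule group_algebra_aut_group)
  have "f \<noteq> 0" using assms(2) by auto
  have "degree (rmod \<sigma> g f) < degree f" for g
    using theI'[OF rmod_unique_existence[OF assms(1) \<open>f \<noteq> 0\<close>, of g]] assms(2)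
    unfolding rmod_def by auto
  then show "x \<otimes>\<^bsub>petit_algebra \<sigma> f\<^esub> y \<in> carrier (petit_algebra \<sigma> f)" for x y
    by (simp add: petit_algebra_def)
  show "x \<oplus>\<^bsub>petit_algebra \<sigma> f\<^esub> y \<in> carrier (petit_algebra \<sigma> f)"
    if "x \<in> carrier (petit_algebra \<sigma> f)" "y \<in> carrier (petit_algebra \<sigma> f)" for x y
    using that by (simp add: petit_algebra_def degree_add_less)
  show "c \<odot>\<^bsub>petit_algebra \<sigma> f\<^esub> x \<in> carrier (petit_algebra \<sigma> f)"
    if "x \<in> carrier (petit_algebra \<sigma> f)" for c x
    using that le_less_trans[OF map_poly_degree_leq] by (simp add: petit_algebra_def)
qed

section \<open>The maps \<open>H\<^sub>\<tau>\<^sub>,\<^sub>k\<close>\<close>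

text \<open>
  The product of \<open>\<sigma>\<^sup>l(k)\<close> over \<open>i \<le> l < n\<close>. It is a list product because \<^const>\<open>prod\<close> needs a
  commutative type; the order of the factors is immaterial for central \<open>k\<close>.
\<close>

definition twisted_prod :: "('a::division_ring \<Rightarrow> 'a) \<Rightarrow> 'a \<Rightarrow> nat \<Rightarrow> nat \<Rightarrow> 'a"
  where "twisted_prod \<sigma> k i n = prod_list (map (\<lambda>l. (\<sigma> ^^ l) k) [i..<n])"

definition H_map :: "('a::division_ring \<Rightarrow> 'a) \<Rightarrow> 'a poly \<Rightarrow> ('a \<Rightarrow> 'a) \<Rightarrow> 'a \<Rightarrow> 'a poly \<Rightarrow> 'a poly"
  where "H_map \<sigma> f \<tau> k = (\<lambda>x \<in> carrier (petit_algebra \<sigma> f).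
    monom (\<tau> (coeff x 0)) 0 +
    (\<Sum>i = 1..degree f - 1. monom (\<tau> (coeff x i) * twisted_prod \<sigma> k 0 i) i))"

end

theory Submission
  imports Defs
begin

text \<open>
  Write \<open>R = D[t;\<sigma>]\<close> and \<open>m\<close> for the degree of \<open>f\<close>. The map \<open>H\<^sub>\<tau>\<^sub>,\<^sub>k\<close> is the restriction of a map
  defined on all of \<open>R\<close>, the twist that applies \<open>\<tau>\<close> to the coefficients and sends \<open>t\<close> to \<open>k t\<close>. If
  \<open>\<tau>\<close> commutes with \<open>\<sigma>\<close> and \<open>k\<close> is central, this twist is a ring endomorphism
  (\<open>twist_skew_mult\<close>), and the twists for \<open>k \<noteq> 0\<close> form a group (\<open>twist_twist\<close>, \<open>twist_inverse\<close>).
  A twist induces an automorphism of \<open>S\<^sub>f\<close> as soon as it sends \<open>f\<close> to a left multiple of \<open>f\<close> by a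
  constant, because it then respects division by \<open>f\<close> (\<open>H_map_in_algebra_auts\<close>). For monic \<open>f\<close>,
  comparing coefficients turns this into the condition on the \<open>a\<^sub>i\<close>
  (\<open>twist_stable_monic_iff\<close>). The subgroup statements follow from the group law of the twists.

  Conversely, let \<open>H\<close> be any automorphism of \<open>S\<^sub>f\<close>, where \<open>f\<close> is not right invariant. Then the left
  nucleus of \<open>S\<^sub>f\<close> consists of the constants only (\<open>left_nucleus_petit_algebra\<close>), so \<open>H\<close> restricts
  to some \<open>\<tau>\<close> in \<open>Aut\<^sub>F(D)\<close>. Applying \<open>H\<close> to \<open>t z = \<sigma>(z) t\<close> shows that each nonzero coefficient
  of \<open>H(t)\<close> at \<open>t\<^sup>i\<close> makes \<open>\<sigma>\<^sup>i\<close> agree with \<open>\<sigma>\<close> on the center. For \<open>2 \<le> i < m\<close> this contradicts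
  the order of \<open>\<sigma>\<close> on the center. For \<open>i = 0\<close> it contradicts \<open>\<sigma> \<noteq> id\<close>, since \<open>\<sigma>\<close> commutes with
  the inner automorphisms, which is possible only for commutative \<open>D\<close>
  (\<open>center_eq_UNIV_if_commutes_with_conjugation\<close>). Hence \<open>H(t) = k t\<close> with \<open>k\<close> central, and
  \<open>H = H\<^sub>\<tau>\<^sub>,\<^sub>k\<close> because \<open>t\<close> and \<open>D\<close> generate \<open>S\<^sub>f\<close>. The condition on the \<open>a\<^sub>i\<close> is what
  multiplicativity says about the product of \<open>t\<close> and \<open>t\<^bsup>m-1\<^esup>\<close>.
\<close>

section \<open>Automorphisms and the center\<close>

lemma ring_autD:
  assumes "ring_aut \<tau>"
  shows "\<tau> 0 = 0" "\<tau> 1 = 1" "\<tau> (x + y) = \<tau> x + \<tau> y" "\<tau> (x * y) = \<tau> x * \<tau> y"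
    "bij \<tau>" "\<tau> x = \<tau> y \<longleftrightarrow> x = y" "\<tau> x = 0 \<longleftrightarrow> x = 0"
  using assms ring_aut_0[OF assms] ring_aut_eq_0[OF assms]
  by (auto simp: ring_aut_def inj_eq[OF bij_is_inj])

lemma ring_aut_inverse:
  assumes "ring_aut \<tau>"
  shows "\<tau> (inverse x) = inverse (\<tau> x)"
proof (cases "x = 0")
  case False
  then have "\<tau> x * \<tau> (inverse x) = 1"
    by (metis assms right_inverse ring_autD(2,4))
  then show ?thesis by (simp add: inverse_unique)
qed (simp add: ring_autD[OF assms])

lemma ring_aut_comp:
  assumes "ring_aut \<tau>" "ring_aut \<rho>"
  shows "ring_aut (\<tau> \<circ> \<rho>)"
  using assms by (auto simp: ring_aut_def intro: bij_comp)

lemma ring_aut_inv_into: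
  assumes "ring_aut \<tau>"
  shows "ring_aut (inv_into UNIV \<tau>)"
    and "\<tau> (inv_into UNIV \<tau> x) = x" and "inv_into UNIV \<tau> (\<tau> x) = x"
proof -
  have b: "bij \<tau>" using assms by (simp add: ring_aut_def)
  show 1: "\<tau> (inv_into UNIV \<tau> x) = x" for x
    using b by (simp add: bij_is_surj surj_f_inv_f)
  show 2: "inv_into UNIV \<tau> (\<tau> x) = x" for x
    using b by (simp add: bij_is_inj)
  have "inv_into UNIV \<tau> (x + y) = inv_into UNIV \<tau> x + inv_into UNIV \<tau> y"
    "inv_into UNIV \<tau> (x * y) = inv_into UNIV \<tau> x * inv_into UNIV \<tau> y" for x y
    by (metis 1 2 assms ring_autD(3)) (metis 1 2 assms ring_autD(4))
  moreover have "inv_into UNIV \<tau> 1 = 1" by (metis 2 assms ring_autD(2))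
  ultimately show "ring_aut (inv_into UNIV \<tau>)"
    using b by (simp add: ring_aut_def bij_imp_bij_inv)
qed

lemma center_commute: "c \<in> center \<Longrightarrow> c * d = d * c"
  by (simp add: center_def)

lemma center_closed:
  "1 \<in> center" "c \<in> center \<Longrightarrow> d \<in> center \<Longrightarrow> c * d \<in> center"
proof -
  show "1 \<in> center" by (simp add: center_def)
  assume "c \<in> center" "d \<in> center"
  have "c * d * x = x * (c * d)" for x
  proof -
    have "c * d * x = c * (x * d)"
      using \<open>d \<in> center\<close> by (simp only: mult.assoc center_commute[of d x])
    also have "\<dots> = x * c * d"
      using \<open>c \<in> center\<close> by (simp only: mult.assoc[symmetric] center_commute[of c x])
    finally show ?thesis by (simp only: mult.assoc)
  qed
  then show "c * d \<in> center" by (simp add: center_def)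
qed

lemma inverse_in_center:
  assumes "c \<in> center"
  shows "inverse c \<in> center"
proof (cases "c = 0")
  case False
  have "inverse c * d = d * inverse c" for d
  proof -
    have "inverse c * d = inverse c * (d * c) * inverse c"
      using False by (simp add: mult.assoc)
    also have "\<dots> = inverse c * (c * d) * inverse c"
      by (simp only: center_commute[OF assms, of d])
    also have "\<dots> = d * inverse c"
      using False by (simp flip: mult.assoc)
    finally show ?thesis .
  qed
  then show ?thesis by (simp add: center_def)
qed (use assms in simp)

lemma ring_aut_center:
  assumes "ring_aut \<tau>" "c \<in> center"
  shows "\<tau> c \<in> center"
proof -
  have "\<tau> c * d = d * \<tau> c" for d
    by (metis assms center_commute ring_autD(4) ring_aut_inv_into(2))
  then show ?thesis by (simp add: center_def)
qed

text \<open>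
  Conjugation by every \<open>d \<noteq> 0\<close> commutes with \<open>\<sigma>\<close> only if \<open>\<sigma>(d) d\<inverse>\<close> is central. Comparing the
  central factors of \<open>d\<close> and \<open>d + 1\<close> shows that both are 1 as soon as \<open>d\<close> itself is not central.
  So \<open>\<sigma>\<close> fixes every noncentral element, and in a noncommutative division ring these elements
  generate everything.
\<close>

lemma center_eq_UNIV_if_commutes_with_conjugation:
  fixes \<sigma> :: "'a::division_ring \<Rightarrow> 'a"
  assumes \<sigma>: "ring_aut \<sigma>" "\<sigma> \<noteq> id"
    and conj: "\<And>d z. d \<noteq> 0 \<Longrightarrow> \<sigma> (d * z * inverse d) = d * \<sigma> z * inverse d"
  shows "(center :: 'a set) = UNIV"
proof (rule ccontr)
  assume "(center :: 'a set) \<noteq> UNIV"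
  then obtain e :: 'a where e: "e \<notin> center" by blast
  have factor: "\<exists>c\<in>center. \<sigma> d = c * d" if "d \<noteq> 0" for d
  proof
    have nz: "\<sigma> d \<noteq> 0" using that \<sigma>(1) by (simp add: ring_autD(7))
    have "inverse d * \<sigma> d * w = w * (inverse d * \<sigma> d)" for w
    proof -
      obtain z where w: "w = \<sigma> z" using ring_aut_inv_into(2)[OF \<sigma>(1)] by metis
      have "\<sigma> d * w * inverse (\<sigma> d) = d * w * inverse d"
        using conj[OF that, of z] by (simp add: w ring_autD(4)[OF \<sigma>(1)] ring_aut_inverse[OF \<sigma>(1)])
      then have "inverse d * (\<sigma> d * w * inverse (\<sigma> d)) * \<sigma> d = inverse d * (d * w * inverse d) * \<sigma> d"
        by simp
      moreover have "inverse d * (\<sigma> d * w * inverse (\<sigma> d)) * \<sigma> d = inverse d * \<sigma> d * w"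
        using nz by (simp add: mult.assoc)
      moreover have "inverse d * (d * w * inverse d) * \<sigma> d = w * (inverse d * \<sigma> d)"
        using that by (simp flip: mult.assoc)
      ultimately show ?thesis by simp
    qed
    then show c: "inverse d * \<sigma> d \<in> center" by (simp add: center_def)
    have "d * (inverse d * \<sigma> d) = \<sigma> d" using that by (simp flip: mult.assoc)
    then show "\<sigma> d = inverse d * \<sigma> d * d" by (simp only: center_commute[OF c, of d])
  qed
  have diff: "x - y \<in> center" if "x \<in> center" "y \<in> center" for x y :: 'a
    using that by (simp add: center_def left_diff_distrib right_diff_distrib)
  have fixed: "\<sigma> d = d" if d: "d \<notin> center" for d
  proof -
    have "0 \<in> (center :: 'a set)" "- 1 \<in> (center :: 'a set)" by (auto simp: center_def)
    then have "d \<noteq> 0" "d + 1 \<noteq> 0" using d by (metis, metis eq_neg_iff_add_eq_0)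
    then obtain c c' where c: "c \<in> center" "\<sigma> d = c * d" "c' \<in> center" "\<sigma> (d + 1) = c' * (d + 1)"
      using factor by metis
    then have eq: "(c' - c) * d = 1 - c'"
      using ring_autD[OF \<sigma>(1)] by (simp add: algebra_simps)
    have "c' = c"
    proof (rule ccontr)
      assume ne: "c' \<noteq> c"
      then have "d = inverse (c' - c) * (1 - c')"
        using eq by (metis left_inverse mult.assoc mult_1 right_minus_eq)
      then show False
        using d diff[OF c(3,1)] diff[OF center_closed(1) c(3)] center_closed(2) inverse_in_center by metis
    qed
    then show ?thesis using eq c(2) by simp
  qed
  have "\<sigma> d = d" for d
  proof (cases "d \<in> center")
    case True
    then have "e + d \<notin> center"
      using e diff[of "e + d" d] by auto
    then show ?thesis
      using fixed[of "e + d"] fixed[OF e] ring_autD(3)[OF \<sigma>(1), of e d] by simp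
  qed (rule fixed)
  then show False using \<sigma>(2) by auto
qed

lemma conjugation_in_Aut_over:
  fixes d :: "'a::division_ring"
  assumes "d \<noteq> 0" "F \<subseteq> center"
  shows "(\<lambda>z. d * z * inverse d) \<in> Aut_over F"
proof -
  have "bij (\<lambda>z. d * z * inverse d)"
  proof (rule bij_betw_byWitness[of _ "\<lambda>z. inverse d * z * d"])
    have "inverse d * (d * z * inverse d) * d = z" "d * (inverse d * z * d) * inverse d = z" for z
      using assms(1) by (simp_all add: mult.assoc) (simp_all flip: mult.assoc)
    then show "\<forall>z\<in>UNIV. inverse d * (d * z * inverse d) * d = z"
      "\<forall>z\<in>UNIV. d * (inverse d * z * d) * inverse d = z" by auto
  qed auto
  moreover have "d * (x * y) * inverse d = d * x * inverse d * (d * y * inverse d)" for x y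
  proof -
    have "d * x * inverse d * (d * y * inverse d) = d * x * ((inverse d * d) * (y * inverse d))"
      by (simp only: mult.assoc)
    also have "\<dots> = d * (x * y) * inverse d" using assms(1) by (simp add: mult.assoc)
    finally show ?thesis by simp
  qed
  moreover have "d * c * inverse d = c" if "c \<in> F" for c
  proof -
    have "d * c = c * d" using that assms(2) center_commute[of c d] by auto
    then show ?thesis using assms(1) by (simp add: mult.assoc)
  qed
  ultimately show ?thesis
    using assms(1) by (simp add: Aut_over_def ring_aut_def algebra_simps)
qed

lemma funpow_not_id_on_if_less_restricted_order:
  fixes \<sigma> :: "'a::division_ring \<Rightarrow> 'a"
  assumes \<sigma>: "ring_aut \<sigma>"
    and ord: "restricted_order \<sigma> center = 0 \<or> n \<le> restricted_order \<sigma> center"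
    and j: "0 < j" "j < n"
  shows "\<exists>c\<in>center. (\<sigma> ^^ j) c \<noteq> c"
proof (rule ccontr)
  assume "\<not> ?thesis"
  then have triv: "\<And>c. c \<in> center \<Longrightarrow> (\<sigma> ^^ j) c = c" by blast
  interpret B: group "BijGroup (center :: 'a set)" by (rule group_BijGroup)
  let ?s = "restrict \<sigma> (center :: 'a set)"
  have "bij_betw \<sigma> center center"
  proof (rule bij_betw_byWitness[of _ "inv_into UNIV \<sigma>"])
    show "\<sigma> ` center \<subseteq> center" using ring_aut_center[OF \<sigma>] by auto
    show "inv_into UNIV \<sigma> ` center \<subseteq> center"
      using ring_aut_center[OF ring_aut_inv_into(1)[OF \<sigma>]] by auto
  qed (auto simp: ring_aut_inv_into[OF \<sigma>])
  then have s: "?s \<in> Bij center" by (auto simp: Bij_def bij_betw_restrict_eq)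
  then have sB: "?s \<in> carrier (BijGroup center)" by (simp add: BijGroup_def)
  have pow: "?s [^]\<^bsub>BijGroup center\<^esub> i = restrict (\<sigma> ^^ i) center" for i :: nat
  proof (induction i)
    case (Suc i)
    have "restrict (\<sigma> ^^ i) center \<in> Bij center"
      using B.nat_pow_closed[OF sB, of i] unfolding Suc by (simp add: BijGroup_def)
    then have "restrict (\<sigma> ^^ i) center \<otimes>\<^bsub>BijGroup center\<^esub> ?s = compose center (restrict (\<sigma> ^^ i) center) ?s"
      using s by (simp add: BijGroup_def)
    then show ?case
      using ring_aut_center[OF \<sigma>]
      by (simp only: nat_pow_Suc Suc) (simp add: compose_def restrict_def fun_eq_iff funpow_swap1)
  qed (auto simp: BijGroup_def restrict_def)
  have "?s [^]\<^bsub>BijGroup center\<^esub> j = \<one>\<^bsub>BijGroup center\<^esub>"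
    unfolding pow using triv by (auto simp: BijGroup_def restrict_def)
  then have "restricted_order \<sigma> center dvd j"
    using B.pow_eq_id[OF sB] by (simp add: restricted_order_def)
  then show False using ord j by (auto dest: dvd_imp_le)
qed

section \<open>Arithmetic of the twisted polynomial ring\<close>

lemma degree_constant [simp]: "degree (monom c 0) = 0"
  by (simp add: monom_0)

lemma skew_mult_distrib:
  assumes "ring_aut \<sigma>"
  shows "skew_mult \<sigma> (p + q) r = skew_mult \<sigma> p r + skew_mult \<sigma> q r"
    and "skew_mult \<sigma> p (q + r) = skew_mult \<sigma> p q + skew_mult \<sigma> p r"
    and "skew_mult \<sigma> (p - q) r = skew_mult \<sigma> p r - skew_mult \<sigma> q r"
    and "skew_mult \<sigma> 0 r = 0" and "skew_mult \<sigma> p 0 = 0"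
proof -
  show a: "skew_mult \<sigma> (p + q) r = skew_mult \<sigma> p r + skew_mult \<sigma> q r" for p q
    using ring.ring_simprules(13)[OF ring_skew_poly_ring[OF assms], of p q r]
    by (simp add: skew_poly_ring_def)
  show b: "skew_mult \<sigma> p (q + r) = skew_mult \<sigma> p q + skew_mult \<sigma> p r" for q r
    using ring.ring_simprules(23)[OF ring_skew_poly_ring[OF assms], of q r p]
    by (simp add: skew_poly_ring_def)
  show "skew_mult \<sigma> (p - q) r = skew_mult \<sigma> p r - skew_mult \<sigma> q r"
    using a[of "p - q" q] by (simp add: algebra_simps)
  show "skew_mult \<sigma> 0 r = 0" "skew_mult \<sigma> p 0 = 0"
    using a[of 0 0] b[of 0 0] by simp_all
qed

lemma coeff_skew_mult_monom:
  assumes "ring_aut \<sigma>"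
  shows "coeff (skew_mult \<sigma> (monom c i) p) n = (if i \<le> n then c * (\<sigma> ^^ i) (coeff p (n - i)) else 0)"
    and "coeff (skew_mult \<sigma> p (monom c i)) n =
      (if i \<le> n then coeff p (n - i) * (\<sigma> ^^ (n - i)) c else 0)"
proof -
  have h0: "(\<sigma> ^^ l) 0 = 0" for l by (rule ring_aut_0[OF ring_aut_funpow[OF assms]])
  have "coeff (skew_mult \<sigma> (monom c i) p) n
      = (\<Sum>l=0..n. if l = i then c * (\<sigma> ^^ i) (coeff p (n - i)) else 0)"
    unfolding coeff_skew_mult[OF assms] by (intro sum.cong) auto
  then show "coeff (skew_mult \<sigma> (monom c i) p) n = (if i \<le> n then c * (\<sigma> ^^ i) (coeff p (n - i)) else 0)"
    by simp
  have "coeff (skew_mult \<sigma> p (monom c i)) n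
      = (\<Sum>l=0..n. if l = n - i then (if i \<le> n then coeff p (n - i) * (\<sigma> ^^ (n - i)) c else 0) else 0)"
    unfolding coeff_skew_mult[OF assms] by (intro sum.cong) (auto simp: h0)
  then show "coeff (skew_mult \<sigma> p (monom c i)) n =
      (if i \<le> n then coeff p (n - i) * (\<sigma> ^^ (n - i)) c else 0)"
    by simp
qed

lemma skew_mult_monom_monom:
  assumes "ring_aut \<sigma>"
  shows "skew_mult \<sigma> (monom c i) (monom d j) = monom (c * (\<sigma> ^^ i) d) (i + j)"
  by (rule poly_eqI) (auto simp: coeff_skew_mult_monom[OF assms] ring_aut_0[OF ring_aut_funpow[OF assms]])

lemma skew_mult_one:
  assumes "ring_aut \<sigma>"
  shows "skew_mult \<sigma> (monom 1 0) p = p" "skew_mult \<sigma> p (monom 1 0) = p"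
  by (rule poly_eqI; simp add: coeff_skew_mult_monom[OF assms] ring_autD(2)[OF ring_aut_funpow[OF assms]])+

lemma coeff_skew_mult_top:
  assumes "ring_aut \<sigma>"
  shows "coeff (skew_mult \<sigma> p q) (degree p + degree q) = lead_coeff p * (\<sigma> ^^ degree p) (lead_coeff q)"
proof -
  have h0: "(\<sigma> ^^ l) 0 = 0" for l by (rule ring_aut_0[OF ring_aut_funpow[OF assms]])
  have z: "coeff p i * (\<sigma> ^^ i) (coeff q (degree p + degree q - i)) = 0" if "i \<noteq> degree p" for i
  proof (cases "i < degree p")
    case True
    then have "degree q < degree p + degree q - i" by simp
    then show ?thesis by (simp add: coeff_eq_0 h0)
  next
    case False
    then show ?thesis using that by (simp add: coeff_eq_0)
  qed
  have "coeff (skew_mult \<sigma> p q) (degree p + degree q)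
      = (\<Sum>i=0..degree p + degree q. if i = degree p then lead_coeff p * (\<sigma> ^^ degree p) (lead_coeff q) else 0)"
    unfolding coeff_skew_mult[OF assms] by (intro sum.cong) (auto simp: z)
  then show ?thesis by simp
qed

lemma degree_skew_mult_le:
  assumes "ring_aut \<sigma>"
  shows "degree (skew_mult \<sigma> p q) \<le> degree p + degree q"
proof (rule degree_le, intro allI impI)
  fix n assume n: "degree p + degree q < n"
  have "coeff p i * (\<sigma> ^^ i) (coeff q (n - i)) = 0" for i
  proof (cases "degree p < i")
    case False
    then have "degree q < n - i" using n by simp
    then show ?thesis by (simp add: coeff_eq_0 ring_aut_0[OF ring_aut_funpow[OF assms]])
  qed (simp add: coeff_eq_0)
  then show "coeff (skew_mult \<sigma> p q) n = 0"
    by (simp add: coeff_skew_mult[OF assms] sum.neutral)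
qed

lemma degree_skew_mult_eq:
  assumes "ring_aut \<sigma>" "p \<noteq> 0" "q \<noteq> 0"
  shows "degree (skew_mult \<sigma> p q) = degree p + degree q"
proof (rule antisym[OF degree_skew_mult_le[OF assms(1)]])
  show "degree p + degree q \<le> degree (skew_mult \<sigma> p q)"
    using assms by (intro le_degree)
      (simp add: coeff_skew_mult_top ring_aut_eq_0[OF ring_aut_funpow[OF assms(1)]])
qed

lemma rmod_decomp:
  assumes "ring_aut \<sigma>" "degree f > 0"
  obtains q r where "g = skew_mult \<sigma> q f + r" "rmod \<sigma> g f = r" "degree r < degree f"
proof -
  have "f \<noteq> 0" using assms(2) by auto
  from theI'[OF rmod_unique_existence[OF assms(1) this, of g]]
  obtain q where "g = skew_mult \<sigma> q f + rmod \<sigma> g f" "rmod \<sigma> g f = 0 \<or> degree (rmod \<sigma> g f) < degree f"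
    unfolding rmod_def by blast
  then show ?thesis using that[OF _ refl] assms(2) by auto
qed

lemma rmod_eqI:
  assumes "ring_aut \<sigma>" "g = skew_mult \<sigma> q f + r" "degree r < degree f"
  shows "rmod \<sigma> g f = r"
proof -
  have "f \<noteq> 0" using assms(3) by auto
  then show ?thesis
    unfolding rmod_def
    using the1_equality[OF rmod_unique_existence[OF assms(1), of f g], of r] assms(2,3) by blast
qed

lemma rmod_small:
  assumes "ring_aut \<sigma>" "degree g < degree f"
  shows "rmod \<sigma> g f = g"
  using rmod_eqI[of \<sigma> g 0 f g] assms by (simp add: skew_mult_distrib)

lemma poly_eq_sum_monom_lessThan:
  assumes "degree p < n"
  shows "p = (\<Sum>i<n. monom (coeff p i) i)"
proof (rule poly_eqI)
  fix j
  show "coeff p j = coeff (\<Sum>i<n. monom (coeff p i) i) j"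
    using assms by (cases "j < n") (auto simp: coeff_sum coeff_eq_0)
qed

text \<open>
  The polynomials \<open>p\<close> with \<open>f p \<in> R f\<close> form a subring (an idealizer), so it suffices to test the
  generators of \<open>R\<close>.
\<close>

lemma right_invariantI:
  fixes \<sigma> :: "'a::division_ring \<Rightarrow> 'a"
  assumes \<sigma>: "ring_aut \<sigma>"
    and const: "\<And>c. \<exists>q. skew_mult \<sigma> f (monom c 0) = skew_mult \<sigma> q f"
    and t: "\<exists>q. skew_mult \<sigma> f (monom 1 1) = skew_mult \<sigma> q f"
  shows "right_invariant \<sigma> f"
proof -
  define E where "E = {p. \<exists>q. skew_mult \<sigma> f p = skew_mult \<sigma> q f}"
  have add: "p + p' \<in> E" if "p \<in> E" "p' \<in> E" for p p'
    using that unfolding E_def by (auto simp: skew_mult_distrib(2)[OF \<sigma>]) (metis skew_mult_distrib(1)[OF \<sigma>])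
  have mult: "skew_mult \<sigma> p p' \<in> E" if "p \<in> E" "p' \<in> E" for p p'
    using that unfolding E_def by (auto simp: skew_mult_assoc[OF \<sigma>, symmetric]) (metis skew_mult_assoc[OF \<sigma>])
  have "monom 1 i \<in> E" for i
  proof (induction i)
    case (Suc i)
    then show ?case
      using mult[of "monom 1 1" "monom 1 i"] t
      by (simp add: skew_mult_monom_monom[OF \<sigma>] E_def ring_autD(2)[OF \<sigma>])
  qed (simp add: E_def const)
  then have "monom c i \<in> E" for c i
    using mult[of "monom c 0" "monom 1 i"] const by (simp add: skew_mult_monom_monom[OF \<sigma>] E_def)
  moreover have "0 \<in> E"
    using skew_mult_distrib(4,5)[OF \<sigma>] by (auto simp: E_def intro: exI[of _ 0])
  ultimately have "(\<Sum>i<n. monom (coeff p i) i) \<in> E" for p n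
    by (induction n) (simp_all add: add)
  then have E: "p \<in> E" for p
    using poly_eq_sum_monom_lessThan[of p "Suc (degree p)"] by (metis lessI)
  let ?R = "skew_poly_ring \<sigma>"
  interpret R: ring ?R by (rule ring_skew_poly_ring[OF \<sigma>])
  have I: "PIdl\<^bsub>?R\<^esub> f = {skew_mult \<sigma> q f | q. True}"
    by (simp add: cgenideal_def skew_poly_ring_def)
  have neg: "\<ominus>\<^bsub>?R\<^esub> p = - p" for p
    by (rule R.minus_equality) (auto simp: skew_poly_ring_def)
  show ?thesis
    unfolding right_invariant_def I
  proof (rule idealI[OF R.ring_axioms])
    show "subgroup {skew_mult \<sigma> q f |q. True} (add_monoid ?R)"
    proof (rule R.add.subgroupI)
      show "{skew_mult \<sigma> q f |q. True} \<subseteq> carrier ?R" by (simp add: skew_poly_ring_def)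
      show "{skew_mult \<sigma> q f |q. True} \<noteq> {}" by blast
      show "\<ominus>\<^bsub>?R\<^esub> p \<in> {skew_mult \<sigma> q f |q. True}" if "p \<in> {skew_mult \<sigma> q f |q. True}" for p
      proof -
        from that obtain q where "p = skew_mult \<sigma> q f" by blast
        then have "- p = skew_mult \<sigma> (0 - q) f"
          by (simp only: skew_mult_distrib[OF \<sigma>]) simp
        then show ?thesis by (auto simp: neg)
      qed
      show "p \<oplus>\<^bsub>?R\<^esub> q \<in> {skew_mult \<sigma> q f |q. True}"
        if "p \<in> {skew_mult \<sigma> q f |q. True}" "q \<in> {skew_mult \<sigma> q f |q. True}" for p q
        using that by (auto simp: skew_poly_ring_def skew_mult_distrib(1)[OF \<sigma>, symmetric])
    qed
    show "x \<otimes>\<^bsub>?R\<^esub> p \<in> {skew_mult \<sigma> q f |q. True}"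
      if "p \<in> {skew_mult \<sigma> q f |q. True}" for p x
      using that by (auto simp: skew_poly_ring_def skew_mult_assoc[OF \<sigma>, symmetric])
    show "p \<otimes>\<^bsub>?R\<^esub> x \<in> {skew_mult \<sigma> q f |q. True}"
      if "p \<in> {skew_mult \<sigma> q f |q. True}" for p x
    proof -
      from that obtain q where q: "p = skew_mult \<sigma> q f" by blast
      from E[of x] obtain q' where "skew_mult \<sigma> f x = skew_mult \<sigma> q' f" by (auto simp: E_def)
      then have "skew_mult \<sigma> p x = skew_mult \<sigma> (skew_mult \<sigma> q q') f"
        by (simp add: q skew_mult_assoc[OF \<sigma>])
      then show ?thesis by (auto simp: skew_poly_ring_def)
    qed
  qed
qed

section \<open>The left nucleus\<close>

definition left_nucleus :: "('b, 'm) monoid_scheme \<Rightarrow> 'b set"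
  where "left_nucleus A = {x \<in> carrier A. \<forall>y\<in>carrier A. \<forall>z\<in>carrier A.
    (x \<otimes>\<^bsub>A\<^esub> y) \<otimes>\<^bsub>A\<^esub> z = x \<otimes>\<^bsub>A\<^esub> (y \<otimes>\<^bsub>A\<^esub> z)}"

lemma algebra_aut_image_left_nucleus:
  assumes closed: "\<And>x y. x \<in> carrier A \<Longrightarrow> y \<in> carrier A \<Longrightarrow> x \<otimes>\<^bsub>A\<^esub> y \<in> carrier A"
    and H: "H \<in> algebra_auts F A"
  shows "H ` left_nucleus A = left_nucleus A"
proof -
  have img: "H ` carrier A = carrier A" and inj: "inj_on H (carrier A)"
    using H by (auto simp: algebra_auts_def Bij_def bij_betw_def)
  have mult: "H (x \<otimes>\<^bsub>A\<^esub> y) = H x \<otimes>\<^bsub>A\<^esub> H y" if "x \<in> carrier A" "y \<in> carrier A" for x y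
    using H that by (auto simp: algebra_auts_def)
  have iff: "H x \<in> left_nucleus A \<longleftrightarrow> x \<in> left_nucleus A" if x: "x \<in> carrier A" for x
  proof -
    have Hx: "H x \<in> carrier A" using img x by blast
    have "H x \<in> left_nucleus A \<longleftrightarrow>
      (\<forall>y\<in>H ` carrier A. \<forall>z\<in>H ` carrier A. (H x \<otimes>\<^bsub>A\<^esub> y) \<otimes>\<^bsub>A\<^esub> z = H x \<otimes>\<^bsub>A\<^esub> (y \<otimes>\<^bsub>A\<^esub> z))"
      using Hx by (simp add: left_nucleus_def img)
    also have "\<dots> \<longleftrightarrow> (\<forall>y\<in>carrier A. \<forall>z\<in>carrier A.
      H ((x \<otimes>\<^bsub>A\<^esub> y) \<otimes>\<^bsub>A\<^esub> z) = H (x \<otimes>\<^bsub>A\<^esub> (y \<otimes>\<^bsub>A\<^esub> z)))"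
      using x by (simp add: mult closed)
    also have "\<dots> \<longleftrightarrow> x \<in> left_nucleus A"
      using x inj by (simp add: left_nucleus_def inj_on_eq_iff closed)
    finally show ?thesis .
  qed
  have sub: "left_nucleus A \<subseteq> carrier A" by (auto simp: left_nucleus_def)
  show ?thesis
  proof
    show "H ` left_nucleus A \<subseteq> left_nucleus A" using iff sub by blast
    show "left_nucleus A \<subseteq> H ` left_nucleus A"
    proof
      fix y assume y: "y \<in> left_nucleus A"
      then obtain x where "x \<in> carrier A" "y = H x" using sub img by (metis imageE subsetD)
      then show "y \<in> H ` left_nucleus A" using y iff by simp
    qed
  qed
qed

lemma petit_simps:
  "carrier (petit_algebra \<sigma> f) = {g. degree g < degree f}"
  "g \<otimes>\<^bsub>petit_algebra \<sigma> f\<^esub> h = rmod \<sigma> (skew_mult \<sigma> g h) f"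
  "g \<oplus>\<^bsub>petit_algebra \<sigma> f\<^esub> h = g + h"
  "c \<odot>\<^bsub>petit_algebra \<sigma> f\<^esub> g = map_poly (\<lambda>x. c * x) g"
  by (simp_all add: petit_algebra_def)

text \<open>
  If \<open>g h = q f + r\<close>, the associator of \<open>g\<close>, \<open>h\<close>, \<open>p\<close> is, up to
  sign, the class of \<open>q f p\<close> modulo \<open>R f\<close>. For
  constant \<open>g\<close> the quotient \<open>q\<close> vanishes. For \<open>g\<close> of degree \<open>d > 0\<close> the choice \<open>h = t\<^bsup>m - d\<^esup>\<close> makes
  \<open>q\<close> a nonzero constant, so that \<open>g\<close> in the left nucleus forces \<open>f p \<in> R f\<close> for all \<open>p\<close>.
\<close>

lemma left_nucleus_petit_algebra:
  fixes \<sigma> :: "'a::division_ring \<Rightarrow> 'a"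
  assumes \<sigma>: "ring_aut \<sigma>" and deg: "degree f \<ge> 2" and ninv: "\<not> right_invariant \<sigma> f"
  shows "left_nucleus (petit_algebra \<sigma> f) = range (\<lambda>c. monom c 0)"
proof
  have pos: "degree f > 0" and fnz: "f \<noteq> 0" using deg by auto
  note assoc = skew_mult_assoc[OF \<sigma>] and distrib = skew_mult_distrib[OF \<sigma>]
  show "range (\<lambda>c. monom c 0) \<subseteq> left_nucleus (petit_algebra \<sigma> f)"
  proof clarify
    fix c
    have small: "rmod \<sigma> (skew_mult \<sigma> (monom c 0) g) f = skew_mult \<sigma> (monom c 0) g"
      if "degree g < degree f" for g
      using degree_skew_mult_le[OF \<sigma>, of "monom c 0" g] that
      by (intro rmod_small[OF \<sigma>]) (simp add: degree_monom_eq)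
    have "rmod \<sigma> (skew_mult \<sigma> (skew_mult \<sigma> (monom c 0) y) z) f
        = rmod \<sigma> (skew_mult \<sigma> (monom c 0) (rmod \<sigma> (skew_mult \<sigma> y z) f)) f" for y z
    proof -
      obtain q r where q: "skew_mult \<sigma> y z = skew_mult \<sigma> q f + r"
        "rmod \<sigma> (skew_mult \<sigma> y z) f = r" "degree r < degree f"
        by (rule rmod_decomp[OF \<sigma> pos])
      have "skew_mult \<sigma> (skew_mult \<sigma> (monom c 0) y) z
        = skew_mult \<sigma> (skew_mult \<sigma> (monom c 0) q) f + skew_mult \<sigma> (monom c 0) r"
        by (simp only: assoc q(1) distrib(2))
      moreover have "degree (skew_mult \<sigma> (monom c 0) r) < degree f"
        using degree_skew_mult_le[OF \<sigma>, of "monom c 0" r] q(3) by (simp add: degree_monom_eq)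
      ultimately have "rmod \<sigma> (skew_mult \<sigma> (skew_mult \<sigma> (monom c 0) y) z) f = skew_mult \<sigma> (monom c 0) r"
        by (rule rmod_eqI[OF \<sigma>])
      then show ?thesis by (simp only: q(2) small[OF q(3)])
    qed
    then show "monom c 0 \<in> left_nucleus (petit_algebra \<sigma> f)"
      using pos small by (simp add: left_nucleus_def petit_simps degree_monom_eq)
  qed
  show "left_nucleus (petit_algebra \<sigma> f) \<subseteq> range (\<lambda>c. monom c 0)"
  proof
    fix g assume g: "g \<in> left_nucleus (petit_algebra \<sigma> f)"
    then have gd: "degree g < degree f" by (simp add: left_nucleus_def petit_simps)
    have "degree g = 0"
    proof (rule ccontr)
      assume d: "degree g \<noteq> 0"
      define h where "h = monom (1::'a) (degree f - degree g)"
      have hd: "degree h = degree f - degree g" "h \<noteq> 0"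
        by (simp_all add: h_def degree_monom_eq monom_eq_0_iff)
      obtain q r where q: "skew_mult \<sigma> g h = skew_mult \<sigma> q f + r"
        "rmod \<sigma> (skew_mult \<sigma> g h) f = r" "degree r < degree f"
        by (rule rmod_decomp[OF \<sigma> pos])
      have gnz: "g \<noteq> 0" using d by auto
      have dgh: "degree (skew_mult \<sigma> g h) = degree f"
        using degree_skew_mult_eq[OF \<sigma> gnz hd(2)] hd(1) gd by simp
      have qnz: "q \<noteq> 0"
        using q dgh distrib(4) by auto
      have "degree (skew_mult \<sigma> q f) = degree f"
      proof -
        have "skew_mult \<sigma> q f = skew_mult \<sigma> g h + - r"
          by (simp add: q(1))
        then show ?thesis
          using q(3) dgh degree_add_eq_left[of "- r" "skew_mult \<sigma> g h"] by simp
      qed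
      then have "degree q = 0" using degree_skew_mult_eq[OF \<sigma> qnz fnz] by simp
      then obtain c where c: "q = monom c 0" "c \<noteq> 0"
        using qnz by (metis degree_eq_zeroE monom_0 monom_eq_0_iff)
      have key: "\<exists>u. skew_mult \<sigma> f p = skew_mult \<sigma> u f" if p: "degree p < degree f" for p
      proof -
        obtain q' s where q': "skew_mult \<sigma> h p = skew_mult \<sigma> q' f + s"
          "rmod \<sigma> (skew_mult \<sigma> h p) f = s"
          by (rule rmod_decomp[OF \<sigma> pos])
        obtain u x where u: "skew_mult \<sigma> r p = skew_mult \<sigma> u f + x" "rmod \<sigma> (skew_mult \<sigma> r p) f = x"
          by (rule rmod_decomp[OF \<sigma> pos])
        obtain v y where v: "skew_mult \<sigma> g s = skew_mult \<sigma> v f + y" "rmod \<sigma> (skew_mult \<sigma> g s) f = y"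
          by (rule rmod_decomp[OF \<sigma> pos])
        have "rmod \<sigma> (skew_mult \<sigma> (rmod \<sigma> (skew_mult \<sigma> g h) f) p) f
            = rmod \<sigma> (skew_mult \<sigma> g (rmod \<sigma> (skew_mult \<sigma> h p) f)) f"
          using g p hd(1) gd d by (simp add: left_nucleus_def petit_simps)
        then have nuc: "x = y" by (simp only: q(2) q'(2) u(2) v(2))
        have "skew_mult \<sigma> (skew_mult \<sigma> q f) p + skew_mult \<sigma> r p = skew_mult \<sigma> (skew_mult \<sigma> g h) p"
          by (simp only: q(1) distrib(1))
        also have "\<dots> = skew_mult \<sigma> (skew_mult \<sigma> g q') f + skew_mult \<sigma> g s"
          by (simp only: assoc q'(1) distrib(2))
        finally have "skew_mult \<sigma> (skew_mult \<sigma> q f) p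
            = skew_mult \<sigma> (skew_mult \<sigma> g q' + v - u) f"
          by (simp add: u(1) v(1) nuc distrib algebra_simps)
        then have "skew_mult \<sigma> (monom (inverse c) 0) (skew_mult \<sigma> q (skew_mult \<sigma> f p))
            = skew_mult \<sigma> (skew_mult \<sigma> (monom (inverse c) 0) (skew_mult \<sigma> g q' + v - u)) f"
          by (simp add: assoc)
        moreover have "skew_mult \<sigma> (monom (inverse c) 0) (skew_mult \<sigma> q w) = w" for w
          using c(2) by (simp add: c(1) assoc[symmetric] skew_mult_monom_monom[OF \<sigma>] skew_mult_one[OF \<sigma>])
        ultimately show ?thesis by auto
      qed
      have "right_invariant \<sigma> f"
        by (rule right_invariantI[OF \<sigma>]; rule key)
          (use deg in \<open>auto simp: degree_monom_eq intro: le_less_trans[OF degree_monom_le]\<close>)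
      then show False using ninv by simp
    qed
    then show "g \<in> range (\<lambda>c. monom c 0)" by (metis degree_eq_zeroE monom_0 rangeI)
  qed
qed

section \<open>Twisted products of central elements\<close>

lemma twisted_prod_0 [simp]: "twisted_prod \<sigma> k i i = 1"
  by (simp add: twisted_prod_def)

lemma twisted_prod_Suc: "i \<le> n \<Longrightarrow> twisted_prod \<sigma> k i (Suc n) = twisted_prod \<sigma> k i n * (\<sigma> ^^ n) k"
  by (simp add: twisted_prod_def)

lemma twisted_prod_split:
  assumes "i \<le> n"
  shows "twisted_prod \<sigma> k 0 n = twisted_prod \<sigma> k 0 i * twisted_prod \<sigma> k i n"
  using assms by (induction n rule: dec_induct) (simp_all add: twisted_prod_Suc mult.assoc)

lemma twisted_prod_add:
  assumes "ring_aut \<sigma>"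
  shows "twisted_prod \<sigma> k 0 (i + j) = twisted_prod \<sigma> k 0 i * (\<sigma> ^^ i) (twisted_prod \<sigma> k 0 j)"
  using ring_autD[OF ring_aut_funpow[OF assms]]
  by (induction j) (simp_all add: twisted_prod_Suc mult.assoc funpow_add)

lemma twisted_prod_center:
  assumes "ring_aut \<sigma>" "k \<in> center"
  shows "twisted_prod \<sigma> k 0 n \<in> center"
  using ring_aut_center[OF ring_aut_funpow[OF assms(1)] assms(2)]
  by (induction n) (simp_all add: twisted_prod_Suc center_closed)

lemma twisted_prod_nonzero:
  assumes "ring_aut \<sigma>" "k \<noteq> 0"
  shows "twisted_prod \<sigma> k 0 n \<noteq> 0"
  using ring_aut_eq_0[OF ring_aut_funpow[OF assms(1)]] assms(2)
  by (induction n) (simp_all add: twisted_prod_Suc)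

lemma twisted_prod_mult:
  assumes "ring_aut \<sigma>" "k \<in> center"
  shows "twisted_prod \<sigma> (k * j) 0 n = twisted_prod \<sigma> k 0 n * twisted_prod \<sigma> j 0 n"
proof (induction n)
  case (Suc n)
  have "(\<sigma> ^^ n) k \<in> center" by (rule ring_aut_center[OF ring_aut_funpow[OF assms(1)] assms(2)])
  then have "twisted_prod \<sigma> j 0 n * (\<sigma> ^^ n) k = (\<sigma> ^^ n) k * twisted_prod \<sigma> j 0 n"
    by (rule center_commute[symmetric])
  then have "twisted_prod \<sigma> j 0 n * ((\<sigma> ^^ n) k * w) = (\<sigma> ^^ n) k * (twisted_prod \<sigma> j 0 n * w)" for w
    by (simp flip: mult.assoc)
  then show ?case
    by (simp add: twisted_prod_Suc Suc ring_autD(4)[OF ring_aut_funpow[OF assms(1)]] mult.assoc)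
qed simp

lemma twisted_prod_one: "ring_aut \<sigma> \<Longrightarrow> twisted_prod \<sigma> 1 0 n = 1"
  by (induction n) (simp_all add: twisted_prod_Suc ring_autD(2)[OF ring_aut_funpow])

lemma funpow_commute:
  assumes "\<tau> \<circ> \<sigma> = \<sigma> \<circ> \<tau>"
  shows "\<tau> ((\<sigma> ^^ n) x) = (\<sigma> ^^ n) (\<tau> x)"
proof (induction n)
  case (Suc n)
  then show ?case using fun_cong[OF assms, of "(\<sigma> ^^ n) x"] by simp
qed simp

lemma ring_aut_twisted_prod:
  assumes "ring_aut \<tau>" "\<tau> \<circ> \<sigma> = \<sigma> \<circ> \<tau>"
  shows "\<tau> (twisted_prod \<sigma> k 0 n) = twisted_prod \<sigma> (\<tau> k) 0 n"
  by (induction n) (simp_all add: twisted_prod_Suc ring_autD[OF assms(1)] funpow_commute[OF assms(2)])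

section \<open>Twists of the polynomial ring\<close>

text \<open>
  The extension of \<open>H\<^sub>\<tau>\<^sub>,\<^sub>k\<close> to the whole ring \<open>R\<close>: it applies \<open>\<tau>\<close> to the coefficients and
  substitutes \<open>k t\<close> for \<open>t\<close>, as \<open>(k t)\<^sup>i = k \<sigma>(k) \<dots> \<sigma>\<^bsup>i-1\<^esup>(k) t\<^sup>i\<close>.
\<close>

definition twist :: "('a::division_ring \<Rightarrow> 'a) \<Rightarrow> ('a \<Rightarrow> 'a) \<Rightarrow> 'a \<Rightarrow> 'a poly \<Rightarrow> 'a poly"
  where "twist \<sigma> \<tau> k p = (\<Sum>i\<le>degree p. monom (\<tau> (coeff p i) * twisted_prod \<sigma> k 0 i) i)"

lemma coeff_twist:
  assumes "ring_aut \<tau>"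
  shows "coeff (twist \<sigma> \<tau> k p) n = \<tau> (coeff p n) * twisted_prod \<sigma> k 0 n"
  by (cases "n \<le> degree p") (auto simp: twist_def coeff_sum coeff_eq_0 ring_autD(1)[OF assms])

lemma degree_twist_le:
  assumes "ring_aut \<tau>"
  shows "degree (twist \<sigma> \<tau> k p) \<le> degree p"
  by (rule degree_le) (simp add: coeff_twist[OF assms] coeff_eq_0 ring_autD(1)[OF assms])

lemma twist_add:
  assumes "ring_aut \<tau>"
  shows "twist \<sigma> \<tau> k (p + q) = twist \<sigma> \<tau> k p + twist \<sigma> \<tau> k q"
  by (rule poly_eqI) (simp add: coeff_twist[OF assms] ring_autD[OF assms] algebra_simps)

lemma twist_skew_mult:
  assumes \<sigma>: "ring_aut \<sigma>" and \<tau>: "ring_aut \<tau>" "\<tau> \<circ> \<sigma> = \<sigma> \<circ> \<tau>" and k: "k \<in> center"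
  shows "twist \<sigma> \<tau> k (skew_mult \<sigma> p q) = skew_mult \<sigma> (twist \<sigma> \<tau> k p) (twist \<sigma> \<tau> k q)"
proof (rule poly_eqI)
  fix n
  let ?P = "twisted_prod \<sigma> k 0"
  have "\<tau> (coeff p i * (\<sigma> ^^ i) (coeff q (n - i))) * ?P n
      = \<tau> (coeff p i) * ?P i * (\<sigma> ^^ i) (\<tau> (coeff q (n - i)) * ?P (n - i))" if "i \<le> n" for i
  proof -
    have "?P n = ?P i * (\<sigma> ^^ i) (?P (n - i))"
      using twisted_prod_add[OF \<sigma>, of k i "n - i"] that by simp
    moreover have "?P i * w = w * ?P i" for w
      using twisted_prod_center[OF \<sigma> k] by (rule center_commute)
    ultimately show ?thesis
      by (simp add: ring_autD(4)[OF \<tau>(1)] ring_autD(4)[OF ring_aut_funpow[OF \<sigma>]]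
        funpow_commute[OF \<tau>(2)] mult.assoc)
  qed
  then show "coeff (twist \<sigma> \<tau> k (skew_mult \<sigma> p q)) n
      = coeff (skew_mult \<sigma> (twist \<sigma> \<tau> k p) (twist \<sigma> \<tau> k q)) n"
    by (simp add: coeff_twist[OF \<tau>(1)] coeff_skew_mult[OF \<sigma>] ring_aut_sum[OF \<tau>(1)] sum_distrib_right)
qed

lemma twist_twist:
  assumes "ring_aut \<sigma>" "ring_aut \<tau>" "\<tau> \<circ> \<sigma> = \<sigma> \<circ> \<tau>" "ring_aut \<rho>" "j \<in> center"
  shows "twist \<sigma> \<tau> k (twist \<sigma> \<rho> j p) = twist \<sigma> (\<tau> \<circ> \<rho>) (\<tau> j * k) p"
  by (rule poly_eqI)
    (simp add: coeff_twist assms ring_aut_comp ring_autD(4)[OF assms(2)] ring_aut_twisted_prod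
      twisted_prod_mult ring_aut_center mult.assoc)

lemma twist_id_one: "ring_aut \<sigma> \<Longrightarrow> twist \<sigma> id 1 p = p"
  by (rule poly_eqI) (simp add: coeff_twist ring_aut_def bij_id twisted_prod_one)

lemma H_map_eq_twist:
  assumes "ring_aut \<tau>" "degree f > 0"
  shows "H_map \<sigma> f \<tau> k = restrict (twist \<sigma> \<tau> k) (carrier (petit_algebra \<sigma> f))"
proof -
  have "monom (\<tau> (coeff x 0)) 0 + (\<Sum>i = 1..degree f - 1. monom (\<tau> (coeff x i) * twisted_prod \<sigma> k 0 i) i)
      = twist \<sigma> \<tau> k x" if "degree x < degree f" for x
  proof (rule poly_eqI)
    fix n
    have "\<tau> (coeff x n) = 0" if "\<not> n < degree f"
      using that \<open>degree x < degree f\<close> by (simp add: coeff_eq_0 ring_autD(1)[OF assms(1)])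
    then show "coeff (monom (\<tau> (coeff x 0)) 0 +
        (\<Sum>i = 1..degree f - 1. monom (\<tau> (coeff x i) * twisted_prod \<sigma> k 0 i) i)) n
        = coeff (twist \<sigma> \<tau> k x) n"
      by (cases "n = 0"; cases "n < degree f")
        (auto simp: coeff_sum coeff_twist[OF assms(1)] intro!: sum.neutral)
  qed
  then show ?thesis by (auto simp: H_map_def petit_simps restrict_def)
qed

text \<open>
  The parameters for which the twist multiplies \<open>f\<close> by a constant from the left. The twist then
  maps \<open>R f\<close> into itself and therefore descends to \<open>S\<^sub>f\<close>. In this form, closure under composition
  and inversion is formal.
\<close>

definition twist_stable :: "('a::division_ring \<Rightarrow> 'a) \<Rightarrow> 'a poly \<Rightarrow> ('a \<Rightarrow> 'a) \<Rightarrow> 'a \<Rightarrow> bool"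
  where "twist_stable \<sigma> f \<tau> k \<longleftrightarrow> ring_aut \<tau> \<and> \<tau> \<circ> \<sigma> = \<sigma> \<circ> \<tau> \<and> k \<in> center \<and> k \<noteq> 0 \<and>
    (\<exists>c. twist \<sigma> \<tau> k f = skew_mult \<sigma> (monom c 0) f)"

lemma twist_stable_id:
  assumes "ring_aut \<sigma>"
  shows "twist_stable \<sigma> f id 1"
  using assms skew_mult_one[OF assms, of f]
  by (auto simp: twist_stable_def twist_id_one ring_aut_def bij_id center_closed intro!: exI[of _ 1])

lemma twist_stable_comp:
  assumes \<sigma>: "ring_aut \<sigma>" and \<tau>: "twist_stable \<sigma> f \<tau> k" and \<rho>: "twist_stable \<sigma> f \<rho> j"
  shows "twist_stable \<sigma> f (\<tau> \<circ> \<rho>) (\<tau> j * k)"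
proof -
  note t = \<tau>[unfolded twist_stable_def] and r = \<rho>[unfolded twist_stable_def]
  obtain c d where cd: "twist \<sigma> \<tau> k f = skew_mult \<sigma> (monom c 0) f"
    "twist \<sigma> \<rho> j f = skew_mult \<sigma> (monom d 0) f"
    using t r by blast
  have "twist \<sigma> (\<tau> \<circ> \<rho>) (\<tau> j * k) f = twist \<sigma> \<tau> k (skew_mult \<sigma> (monom d 0) f)"
    using t r by (simp add: twist_twist[OF \<sigma>, symmetric] cd)
  also have "\<dots> = skew_mult \<sigma> (twist \<sigma> \<tau> k (monom d 0)) (skew_mult \<sigma> (monom c 0) f)"
    using t by (simp add: twist_skew_mult[OF \<sigma>] cd)
  also have "twist \<sigma> \<tau> k (monom d 0) = monom (\<tau> d) 0"
    using t by (auto intro!: poly_eqI simp: coeff_twist ring_autD(1))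
  finally have "twist \<sigma> (\<tau> \<circ> \<rho>) (\<tau> j * k) f = skew_mult \<sigma> (monom (\<tau> d * c) 0) f"
    by (simp only: skew_mult_assoc[OF \<sigma>, symmetric] skew_mult_monom_monom[OF \<sigma>] funpow_0 add_0_left)
  moreover have "\<tau> \<circ> \<rho> \<circ> \<sigma> = \<sigma> \<circ> (\<tau> \<circ> \<rho>)" using t r by (metis comp_assoc)
  ultimately show ?thesis
    using t r ring_aut_comp[of \<tau> \<rho>] center_closed(2) ring_aut_center[of \<tau> j] ring_autD(7)[of \<tau> j]
    unfolding twist_stable_def by fastforce
qed

lemma twist_inverse:
  fixes \<sigma> \<tau> :: "'a::division_ring \<Rightarrow> 'a" and k :: 'a
  assumes \<sigma>: "ring_aut \<sigma>" and \<tau>: "ring_aut \<tau>" "\<tau> \<circ> \<sigma> = \<sigma> \<circ> \<tau>" and k: "k \<in> center" "k \<noteq> 0"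
  defines "\<tau>' \<equiv> inv_into UNIV \<tau>"
  defines "k' \<equiv> \<tau>' (inverse k)"
  shows "twist \<sigma> \<tau> k (twist \<sigma> \<tau>' k' p) = p" and "twist \<sigma> \<tau>' k' (twist \<sigma> \<tau> k p) = p"
    and "ring_aut \<tau>'" "\<tau>' \<circ> \<sigma> = \<sigma> \<circ> \<tau>'" "k' \<in> center" "k' \<noteq> 0"
proof -
  note i = ring_aut_inv_into[OF \<tau>(1), folded \<tau>'_def]
  show 1: "ring_aut \<tau>'" by (rule i(1))
  show 2: "\<tau>' \<circ> \<sigma> = \<sigma> \<circ> \<tau>'"
    using i(2,3) fun_cong[OF \<tau>(2)] by (auto simp: fun_eq_iff) metis
  show 3: "k' \<in> center" by (simp add: k'_def ring_aut_center[OF 1] inverse_in_center[OF k(1)])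
  show "k' \<noteq> 0" using k(2) by (simp add: k'_def ring_autD(7)[OF 1])
  have "\<tau> \<circ> \<tau>' = id" "\<tau>' \<circ> \<tau> = id" using i by auto
  moreover have "\<tau> k' * k = 1" using k by (simp add: k'_def i)
  moreover have "\<tau>' k * k' = 1"
    using k(2) ring_autD(2)[OF 1] ring_autD(4)[OF 1, of k "inverse k"] by (simp add: k'_def)
  ultimately show "twist \<sigma> \<tau> k (twist \<sigma> \<tau>' k' p) = p" "twist \<sigma> \<tau>' k' (twist \<sigma> \<tau> k p) = p"
    by (simp_all add: twist_twist[OF \<sigma> \<tau> 1 3] twist_twist[OF \<sigma> 1 2 \<tau>(1) k(1)] twist_id_one[OF \<sigma>])
qed

lemma twist_stable_inverse:
  assumes \<sigma>: "ring_aut \<sigma>" and \<tau>: "twist_stable \<sigma> f \<tau> k" and f: "f \<noteq> 0"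
  shows "twist_stable \<sigma> f (inv_into UNIV \<tau>) (inv_into UNIV \<tau> (inverse k))"
proof -
  let ?\<tau> = "inv_into UNIV \<tau>" and ?k = "inv_into UNIV \<tau> (inverse k)"
  note t = \<tau>[unfolded twist_stable_def]
  obtain c where c: "twist \<sigma> \<tau> k f = skew_mult \<sigma> (monom c 0) f" using t by blast
  have inv: "twist \<sigma> ?\<tau> ?k (twist \<sigma> \<tau> k f) = f" "ring_aut ?\<tau>" "?\<tau> \<circ> \<sigma> = \<sigma> \<circ> ?\<tau>"
    "?k \<in> center" "?k \<noteq> 0"
    using t twist_inverse[OF \<sigma>, of \<tau> k] by auto
  have m: "twist \<sigma> ?\<tau> ?k (monom c 0) = monom (?\<tau> c) 0"
    by (auto intro!: poly_eqI simp: coeff_twist inv(2) ring_autD(1)[OF inv(2)])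
  have e: "skew_mult \<sigma> (monom (?\<tau> c) 0) (twist \<sigma> ?\<tau> ?k f) = f"
    using inv(1) by (simp add: c twist_skew_mult[OF \<sigma> inv(2-4)] m)
  have nz: "?\<tau> c \<noteq> 0"
  proof
    assume "?\<tau> c = 0"
    with e f show False by (simp add: skew_mult_distrib[OF \<sigma>])
  qed
  have "skew_mult \<sigma> (monom (inverse (?\<tau> c)) 0) f
      = skew_mult \<sigma> (monom (inverse (?\<tau> c)) 0) (skew_mult \<sigma> (monom (?\<tau> c) 0) (twist \<sigma> ?\<tau> ?k f))"
    by (simp add: e)
  also have "\<dots> = twist \<sigma> ?\<tau> ?k f"
    using nz by (simp add: skew_mult_assoc[OF \<sigma>, symmetric] skew_mult_monom_monom[OF \<sigma>] skew_mult_one[OF \<sigma>])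
  finally have "twist \<sigma> ?\<tau> ?k f = skew_mult \<sigma> (monom (inverse (?\<tau> c)) 0) f" by (rule sym)
  then show ?thesis using inv(2-5) unfolding twist_stable_def by blast
qed

lemma H_map_in_algebra_auts:
  fixes \<sigma> :: "'a::division_ring \<Rightarrow> 'a"
  assumes \<sigma>: "ring_aut \<sigma>" and \<tau>: "twist_stable \<sigma> f \<tau> k" and deg: "degree f > 0"
    and fixF: "\<And>c. c \<in> F \<Longrightarrow> \<tau> c = c"
  shows "H_map \<sigma> f \<tau> k \<in> algebra_auts F (petit_algebra \<sigma> f)"
proof -
  let ?A = "petit_algebra \<sigma> f"
  let ?T = "twist \<sigma> \<tau> k"
  let ?T' = "twist \<sigma> (inv_into UNIV \<tau>) (inv_into UNIV \<tau> (inverse k))"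
  note t = \<tau>[unfolded twist_stable_def]
  obtain c where c: "?T f = skew_mult \<sigma> (monom c 0) f" using t by blast
  have d: "degree (?T p) \<le> degree p" for p using t by (simp add: degree_twist_le)
  have d': "degree (?T' p) \<le> degree p" for p
    using t by (simp add: degree_twist_le ring_aut_inv_into)
  have H: "H_map \<sigma> f \<tau> k = restrict ?T (carrier ?A)" using t deg by (simp add: H_map_eq_twist)
  have "bij_betw ?T (carrier ?A) (carrier ?A)"
    using t twist_inverse[OF \<sigma>, of \<tau> k]
    by (intro bij_betw_byWitness[of _ ?T'])
      (auto simp: petit_simps intro: le_less_trans[OF d] le_less_trans[OF d'])
  then have "H_map \<sigma> f \<tau> k \<in> Bij (carrier ?A)"
    by (simp add: H Bij_def bij_betw_restrict_eq)
  moreover have "?T (map_poly (\<lambda>x. e * x) p) = map_poly (\<lambda>x. e * x) (?T p)" if "e \<in> F" for e p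
    using t fixF[OF that]
    by (intro poly_eqI) (simp add: coeff_twist coeff_map_poly ring_autD(4) mult.assoc)
  moreover have "degree (map_poly (\<lambda>x. e * x) p) < degree f" if "degree p < degree f" for e :: 'a and p
    using that le_less_trans[OF map_poly_degree_leq] by blast
  moreover have "rmod \<sigma> (skew_mult \<sigma> (?T p) (?T q)) f = ?T (rmod \<sigma> (skew_mult \<sigma> p q) f)
      \<and> degree (rmod \<sigma> (skew_mult \<sigma> p q) f) < degree f" for p q
  proof -
    obtain u r where u: "skew_mult \<sigma> p q = skew_mult \<sigma> u f + r"
      "rmod \<sigma> (skew_mult \<sigma> p q) f = r" "degree r < degree f"
      by (rule rmod_decomp[OF \<sigma> deg])
    have "skew_mult \<sigma> (?T p) (?T q) = ?T (skew_mult \<sigma> u f + r)"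
      using t by (simp add: twist_skew_mult[OF \<sigma>] u(1)[symmetric])
    also have "\<dots> = skew_mult \<sigma> (skew_mult \<sigma> (?T u) (monom c 0)) f + ?T r"
      using t by (simp add: twist_skew_mult[OF \<sigma>] twist_add c skew_mult_assoc[OF \<sigma>])
    finally show ?thesis
      using rmod_eqI[OF \<sigma>] u(2,3) le_less_trans[OF d u(3)] by blast
  qed
  ultimately show ?thesis
    using t by (simp add: algebra_auts_def H petit_simps twist_add degree_add_less)
qed

text \<open>
  Allowing an arbitrary group \<open>T\<close> of coefficient automorphisms covers both \<open>T = {id}\<close> and the
  full centralizer of \<open>\<sigma>\<close> in \<open>Aut\<^sub>F(D)\<close>.
\<close>

lemma subgroup_H_maps:
  fixes \<sigma> :: "'a::division_ring \<Rightarrow> 'a"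
  assumes \<sigma>: "ring_aut \<sigma>" and deg: "degree f > 0"
    and T: "T \<subseteq> Aut_over F" "id \<in> T" "\<And>\<tau> \<rho>. \<tau> \<in> T \<Longrightarrow> \<rho> \<in> T \<Longrightarrow> \<tau> \<circ> \<rho> \<in> T"
      "\<And>\<tau>. \<tau> \<in> T \<Longrightarrow> inv_into UNIV \<tau> \<in> T"
  shows "subgroup {H_map \<sigma> f \<tau> k | \<tau> k. \<tau> \<in> T \<and> twist_stable \<sigma> f \<tau> k}
    (algebra_aut_group F (petit_algebra \<sigma> f))" (is "subgroup ?U ?G")
proof -
  let ?A = "petit_algebra \<sigma> f"
  interpret G: group ?G by (rule group_petit_aut_group[OF \<sigma> deg])
  have aut: "H_map \<sigma> f \<tau> k \<in> algebra_auts F ?A" if "\<tau> \<in> T" "twist_stable \<sigma> f \<tau> k" for \<tau> k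
    using T(1) that by (intro H_map_in_algebra_auts[OF \<sigma>] deg) (auto simp: Aut_over_def)
  have Gs: "carrier ?G = algebra_auts F ?A" "\<one>\<^bsub>?G\<^esub> = (\<lambda>x\<in>carrier ?A. x)"
    by (simp_all add: algebra_aut_group_def BijGroup_def)
  have law: "H_map \<sigma> f \<tau> k \<otimes>\<^bsub>?G\<^esub> H_map \<sigma> f \<rho> j = restrict (twist \<sigma> \<tau> k \<circ> twist \<sigma> \<rho> j) (carrier ?A)"
    if "\<tau> \<in> T" "twist_stable \<sigma> f \<tau> k" "\<rho> \<in> T" "twist_stable \<sigma> f \<rho> j" for \<tau> k \<rho> j
  proof -
    have "degree (twist \<sigma> \<rho> j p) < degree f" if "degree p < degree f" for p
      using that \<open>twist_stable \<sigma> f \<rho> j\<close> le_less_trans[OF degree_twist_le] by (auto simp: twist_stable_def)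
    moreover have "H_map \<sigma> f \<tau> k \<in> Bij (carrier ?A)" "H_map \<sigma> f \<rho> j \<in> Bij (carrier ?A)"
      using aut that by (auto simp: algebra_auts_def)
    ultimately show ?thesis
      using that deg
      by (auto simp: algebra_aut_group_def BijGroup_def H_map_eq_twist twist_stable_def compose_def
        petit_simps fun_eq_iff)
  qed
  show ?thesis
  proof (rule G.subgroupI)
    show "?U \<subseteq> carrier ?G" using aut by (auto simp: Gs)
    show "?U \<noteq> {}" using T(2) twist_stable_id[OF \<sigma>] by blast
  next
    fix H assume "H \<in> ?U"
    then obtain \<tau> k where H: "H = H_map \<sigma> f \<tau> k" "\<tau> \<in> T" "twist_stable \<sigma> f \<tau> k" by blast
    let ?\<tau> = "inv_into UNIV \<tau>" and ?k = "inv_into UNIV \<tau> (inverse k)"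
    have f: "f \<noteq> 0" using deg by auto
    note st = T(4)[OF H(2)] twist_stable_inverse[OF \<sigma> H(3) f]
    have "H_map \<sigma> f ?\<tau> ?k \<otimes>\<^bsub>?G\<^esub> H = \<one>\<^bsub>?G\<^esub>"
      using H(3) twist_inverse[OF \<sigma>, of \<tau> k] unfolding H(1) law[OF st H(2,3)] Gs
      by (auto simp: twist_stable_def restrict_def)
    then have "inv\<^bsub>?G\<^esub> H = H_map \<sigma> f ?\<tau> ?k"
      using aut[OF st] aut[OF H(2,3)] by (intro G.inv_equality) (auto simp: Gs H(1))
    then show "inv\<^bsub>?G\<^esub> H \<in> ?U" using st by blast
  next
    fix H K assume "H \<in> ?U" "K \<in> ?U"
    then obtain \<tau> k \<rho> j where HK: "H = H_map \<sigma> f \<tau> k" "\<tau> \<in> T" "twist_stable \<sigma> f \<tau> k"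
      "K = H_map \<sigma> f \<rho> j" "\<rho> \<in> T" "twist_stable \<sigma> f \<rho> j" by blast
    have "H \<otimes>\<^bsub>?G\<^esub> K = H_map \<sigma> f (\<tau> \<circ> \<rho>) (\<tau> j * k)"
      unfolding HK(1,4) law[OF HK(2,3,5,6)]
      using HK(3,6) deg twist_twist[OF \<sigma>, of \<tau> \<rho> j k]
      by (auto simp: H_map_eq_twist twist_stable_def ring_aut_comp restrict_def fun_eq_iff)
    then show "H \<otimes>\<^bsub>?G\<^esub> K \<in> ?U"
      using T(3)[OF HK(2,5)] twist_stable_comp[OF \<sigma> HK(3,6)] by blast
  qed
qed

section \<open>Monic polynomials\<close>

lemma monic_poly_facts:
  fixes a :: "nat \<Rightarrow> 'a::division_ring" and m :: nat
  defines "f \<equiv> monom 1 m - (\<Sum>i<m. monom (a i) i)"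
  shows "coeff f i = (if i < m then - a i else if i = m then 1 else 0)" and "degree f = m"
proof -
  show c: "coeff f i = (if i < m then - a i else if i = m then 1 else 0)" for i
    by (auto simp: f_def coeff_sum)
  show "degree f = m"
    by (rule antisym[OF degree_le le_degree]) (auto simp: c)
qed

lemma twisted_prod_cancel:
  assumes "ring_aut \<sigma>" "k \<in> center" "k \<noteq> 0" "i \<le> m"
  shows "x * twisted_prod \<sigma> k 0 i = twisted_prod \<sigma> k 0 m * y \<longleftrightarrow> x = twisted_prod \<sigma> k i m * y"
proof -
  have "x * twisted_prod \<sigma> k 0 i = twisted_prod \<sigma> k 0 i * x"
    by (rule center_commute[symmetric, OF twisted_prod_center[OF assms(1,2)]])
  then show ?thesis
    using mult_left_cancel[OF twisted_prod_nonzero[OF assms(1,3)]]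
    by (simp only: twisted_prod_split[OF assms(4)] mult.assoc)
qed

lemma twist_stable_monic_iff:
  fixes a :: "nat \<Rightarrow> 'a::division_ring" and m :: nat
  defines "f \<equiv> monom 1 m - (\<Sum>i<m. monom (a i) i)"
  assumes \<sigma>: "ring_aut \<sigma>"
  shows "twist_stable \<sigma> f \<tau> k \<longleftrightarrow> ring_aut \<tau> \<and> \<tau> \<circ> \<sigma> = \<sigma> \<circ> \<tau> \<and> k \<in> center \<and> k \<noteq> 0 \<and>
    (\<forall>i<m. \<tau> (a i) = twisted_prod \<sigma> k i m * a i)"
proof -
  let ?P = "twisted_prod \<sigma> k"
  have "(\<exists>c. twist \<sigma> \<tau> k f = skew_mult \<sigma> (monom c 0) f) \<longleftrightarrow> (\<forall>i<m. \<tau> (a i) = ?P i m * a i)"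
    if \<tau>: "ring_aut \<tau>" and k: "k \<in> center" "k \<noteq> 0"
  proof -
    note cf = monic_poly_facts(1)[of m a, folded f_def]
    have neg: "\<tau> (- x) = - \<tau> x" for x
      using ring_autD(3)[OF \<tau>, of x "- x"] ring_autD(1)[OF \<tau>] by (simp add: eq_neg_iff_add_eq_0 add.commute)
    have "twist \<sigma> \<tau> k f = skew_mult \<sigma> (monom c 0) f \<longleftrightarrow>
        (\<forall>i. \<tau> (coeff f i) * ?P 0 i = c * coeff f i)" for c
      by (simp add: poly_eq_iff coeff_twist[OF \<tau>] coeff_skew_mult_monom[OF \<sigma>])
    also have "\<dots> c \<longleftrightarrow> c = ?P 0 m \<and> (\<forall>i<m. \<tau> (a i) * ?P 0 i = c * a i)" for c
      unfolding cf using ring_autD(1,2)[OF \<tau>] neg by (auto split: if_splits)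
    finally show ?thesis using twisted_prod_cancel[OF \<sigma> k] by auto
  qed
  then show ?thesis by (auto simp: twist_stable_def)
qed

section \<open>The shape of an arbitrary automorphism\<close>

lemma algebra_autD:
  assumes "H \<in> algebra_auts F (petit_algebra \<sigma> f)"
  shows "degree p < degree f \<Longrightarrow> degree (H p) < degree f"
    and "degree p < degree f \<Longrightarrow> degree q < degree f \<Longrightarrow> H (p + q) = H p + H q"
    and "degree p < degree f \<Longrightarrow> c \<in> F \<Longrightarrow> H (map_poly (\<lambda>x. c * x) p) = map_poly (\<lambda>x. c * x) (H p)"
    and "degree p < degree f \<Longrightarrow> degree q < degree f \<Longrightarrow>
      H (rmod \<sigma> (skew_mult \<sigma> p q) f) = rmod \<sigma> (skew_mult \<sigma> (H p) (H q)) f"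
    and "degree p < degree f \<Longrightarrow> degree q < degree f \<Longrightarrow> H p = H q \<longleftrightarrow> p = q"
    and "H \<in> extensional {g. degree g < degree f}"
  using assms
  by (auto simp: algebra_auts_def petit_simps Bij_def bij_betw_def inj_on_eq_iff)

lemma algebra_aut_skew_mult:
  assumes "ring_aut \<sigma>" "H \<in> algebra_auts F (petit_algebra \<sigma> f)"
    and "degree p < degree f" "degree q < degree f"
    and "degree p + degree q < degree f" "degree (H p) + degree (H q) < degree f"
  shows "H (skew_mult \<sigma> p q) = skew_mult \<sigma> (H p) (H q)"
proof -
  have "rmod \<sigma> (skew_mult \<sigma> p q) f = skew_mult \<sigma> p q"
    "rmod \<sigma> (skew_mult \<sigma> (H p) (H q)) f = skew_mult \<sigma> (H p) (H q)"
    using assms(5,6) by (auto intro!: rmod_small[OF assms(1)] le_less_trans[OF degree_skew_mult_le[OF assms(1)]])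
  then show ?thesis using algebra_autD(4)[OF assms(2-4)] by simp
qed

text \<open>
  Automorphisms preserve the left nucleus, which here is a copy of \<open>D\<close>; linearity over \<open>F\<close>
  means that the induced automorphism of \<open>D\<close> fixes \<open>F\<close>.
\<close>

lemma algebra_aut_restricts_to_constants:
  fixes \<sigma> :: "'a::division_ring \<Rightarrow> 'a"
  assumes \<sigma>: "ring_aut \<sigma>" and deg: "degree f \<ge> 2" and ninv: "\<not> right_invariant \<sigma> f"
    and H: "H \<in> algebra_auts F (petit_algebra \<sigma> f)"
  obtains \<tau> where "\<tau> \<in> Aut_over F" "\<And>x. H (monom x 0) = monom (\<tau> x) 0"
proof
  define \<tau> where "\<tau> x = coeff (H (monom x 0)) 0" for x
  have pos: "degree f > 0" using deg by simp
  have d0: "degree (monom x 0) < degree f" for x :: 'a using pos by (simp add: degree_monom_eq)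
  have "H ` left_nucleus (petit_algebra \<sigma> f) = left_nucleus (petit_algebra \<sigma> f)"
  proof (rule algebra_aut_image_left_nucleus[OF _ H])
    show "x \<otimes>\<^bsub>petit_algebra \<sigma> f\<^esub> y \<in> carrier (petit_algebra \<sigma> f)" for x y
      by (rule rmod_decomp[OF \<sigma> pos, of "skew_mult \<sigma> x y"]) (simp add: petit_simps)
  qed
  then have img: "H ` range (\<lambda>x. monom x 0) = range (\<lambda>x. monom x 0)"
    by (simp add: left_nucleus_petit_algebra[OF \<sigma> deg ninv])
  show Hx: "H (monom x 0) = monom (\<tau> x) 0" for x
  proof -
    have "H (monom x 0) \<in> range (\<lambda>x. monom x 0)" using img by blast
    then show ?thesis by (auto simp: \<tau>_def)
  qed
  have inj: "\<tau> x = \<tau> y \<longleftrightarrow> x = y" for x y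
    using algebra_autD(5)[OF H d0 d0, of x y] by (simp add: Hx monom_eq_iff)
  have surj: "\<exists>x. \<tau> x = y" for y
  proof -
    have "monom y 0 \<in> H ` range (\<lambda>x. monom x 0)" unfolding img by blast
    then show ?thesis by (auto simp: Hx monom_eq_iff)
  qed
  have add: "\<tau> (x + y) = \<tau> x + \<tau> y" for x y
    using algebra_autD(2)[OF H d0 d0, of x y] by (simp add: Hx add_monom monom_eq_iff)
  have mult: "\<tau> (x * y) = \<tau> x * \<tau> y" for x y
    using algebra_aut_skew_mult[OF \<sigma> H d0 d0, of x y] pos
    by (simp add: Hx degree_monom_eq skew_mult_monom_monom[OF \<sigma>] monom_eq_iff)
  have "\<tau> 0 = 0" using add[of 0 0] by simp
  then have "\<tau> 1 \<noteq> 0" using inj[of 1 0] by simp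
  then have one: "\<tau> 1 = 1" using mult[of 1 1] by (metis mult_1 mult_1_right mult_left_cancel)
  have "\<tau> c = c" if "c \<in> F" for c
    using algebra_autD(3)[OF H d0 that, of 1]
    by (simp add: Hx one map_poly_monom monom_eq_iff)
  moreover have "bij \<tau>" using inj surj by (auto simp: bij_def inj_def surj_def) metis
  ultimately show "\<tau> \<in> Aut_over F"
    by (simp add: Aut_over_def ring_aut_def add mult one)
qed

text \<open>
  The relation \<open>t z = \<sigma>(z) t\<close> forces every coefficient \<open>g\<^sub>i\<close> of the image \<open>g\<close> of \<open>t\<close> to satisfy
  \<open>g\<^sub>i \<sigma>\<^sup>i(w) = \<sigma>(w) g\<^sub>i\<close>. If \<open>g\<^sub>i \<noteq> 0\<close>, then \<open>\<sigma>\<^sup>i\<close> and \<open>\<sigma>\<close> agree on the center, which is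
  impossible for \<open>i \<noteq> 1\<close>: for \<open>i = 0\<close> because \<open>\<sigma>\<close> moves a central element, for \<open>i \<ge> 2\<close> because
  \<open>0 < i - 1 < m - 1\<close>.
\<close>

lemma algebra_aut_image_of_t:
  fixes \<sigma> :: "'a::division_ring \<Rightarrow> 'a"
  assumes \<sigma>: "ring_aut \<sigma>" and deg: "degree f \<ge> 2"
    and H: "H \<in> algebra_auts F (petit_algebra \<sigma> f)"
    and \<tau>: "ring_aut \<tau>" "\<tau> \<circ> \<sigma> = \<sigma> \<circ> \<tau>" "\<And>x. H (monom x 0) = monom (\<tau> x) 0"
    and nontriv: "\<exists>c\<in>center. \<sigma> c \<noteq> c"
    and ord: "restricted_order \<sigma> center = 0 \<or> degree f - 1 \<le> restricted_order \<sigma> center"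
  obtains k where "k \<in> center" "k \<noteq> 0" "H (monom 1 1) = monom k 1"
proof
  define g where "g = H (monom 1 1)"
  have d0: "degree (monom x 0) < degree f" for x :: 'a using deg by (simp add: degree_monom_eq)
  have d1: "degree (monom 1 1 :: 'a poly) < degree f" using deg by (simp add: degree_monom_eq)
  have dg: "degree g < degree f" unfolding g_def by (rule algebra_autD(1)[OF H d1])
  have Ht: "H (monom 1 (Suc 0)) = g" by (simp add: g_def)
  have rel: "coeff g i * (\<sigma> ^^ i) w = \<sigma> w * coeff g i" for i w
  proof -
    obtain z where w: "w = \<tau> z" using ring_aut_inv_into(2)[OF \<tau>(1)] by metis
    have "skew_mult \<sigma> g (monom w 0) = H (skew_mult \<sigma> (monom 1 1) (monom z 0))"
      using algebra_aut_skew_mult[OF \<sigma> H d1 d0, of z] deg dg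
      by (simp add: \<tau>(3) w Ht degree_monom_eq)
    also have "\<dots> = H (skew_mult \<sigma> (monom (\<sigma> z) 0) (monom 1 1))"
      using skew_mult_t[OF \<sigma>] by metis
    also have "\<dots> = skew_mult \<sigma> (monom (\<sigma> w) 0) g"
      using algebra_aut_skew_mult[OF \<sigma> H d0 d1, of "\<sigma> z"] deg dg fun_cong[OF \<tau>(2), of z]
      by (simp add: \<tau>(3) w Ht degree_monom_eq)
    finally have "coeff (skew_mult \<sigma> g (monom w 0)) i = coeff (skew_mult \<sigma> (monom (\<sigma> w) 0) g) i"
      by simp
    then show ?thesis by (simp add: coeff_skew_mult_monom[OF \<sigma>])
  qed
  have zero: "coeff g i = 0" if i: "i \<noteq> 1" for i
  proof (rule ccontr)
    assume nz: "coeff g i \<noteq> 0"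
    then have "i < degree f" using le_degree dg le_less_trans by blast
    have agree: "(\<sigma> ^^ i) c = \<sigma> c" if "c \<in> center" for c
      using rel[of i c] center_commute[OF ring_aut_center[OF \<sigma> that], of "coeff g i"] nz by simp
    show False
    proof (cases i)
      case 0
      then show False using agree nontriv by auto
    next
      case (Suc j)
      have "(\<sigma> ^^ j) c = c" if "c \<in> center" for c
        using agree[OF that] by (simp add: Suc ring_autD(6)[OF \<sigma>])
      moreover have "0 < j" "j < degree f - 1" using i Suc \<open>i < degree f\<close> by auto
      ultimately show False
        using funpow_not_id_on_if_less_restricted_order[OF \<sigma> ord] by blast
    qed
  qed
  have "g = monom (coeff g 1) 1" by (rule poly_eqI) (auto simp: zero)
  then show mon: "H (monom 1 1) = monom (coeff g 1) 1" by (simp add: g_def)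
  have "coeff g 1 * w = w * coeff g 1" for w
    using rel[of 1 "inv_into UNIV \<sigma> w"] by (simp add: ring_aut_inv_into[OF \<sigma>])
  then show "coeff g 1 \<in> center" by (simp add: center_def)
  have "H (monom 1 1) \<noteq> H (monom 0 0)"
    using algebra_autD(5)[OF H d1 d0, of 0] by (simp add: monom_eq_0_iff)
  moreover have "H (monom 0 0) = monom 0 1"
    by (simp only: \<tau>(3) ring_autD(1)[OF \<tau>(1)]) simp
  ultimately show "coeff g 1 \<noteq> 0" unfolding mon by auto
qed

text \<open>
  All products \<open>x t\<^sup>i = x \<sqdot> (t \<sqdot> (\<dots> (t \<sqdot> t)))\<close> with \<open>i < m\<close> are formed without reduction
  modulo \<open>f\<close>, so the values of \<open>H\<close> on \<open>D\<close> and at \<open>t\<close> determine \<open>H\<close>.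
\<close>

lemma algebra_aut_eq_H_map:
  fixes \<sigma> :: "'a::division_ring \<Rightarrow> 'a"
  assumes \<sigma>: "ring_aut \<sigma>" and deg: "degree f \<ge> 2"
    and H: "H \<in> algebra_auts F (petit_algebra \<sigma> f)"
    and \<tau>: "ring_aut \<tau>" "\<And>x. H (monom x 0) = monom (\<tau> x) 0"
    and k: "H (monom 1 1) = monom k 1"
  shows "H = H_map \<sigma> f \<tau> k"
proof -
  have dm: "degree (monom c i) < degree f" if "i < degree f" for c :: 'a and i
    using that by (rule le_less_trans[OF degree_monom_le])
  have dp: "degree (monom c i) + degree (monom d j) < degree f" if "i + j < degree f" for c d :: 'a and i j
    using that degree_monom_le[of c i] degree_monom_le[of d j] by simp
  have k': "H (monom 1 (Suc 0)) = monom k (Suc 0)" using k by simp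
  have t_pow: "H (monom 1 i) = monom (twisted_prod \<sigma> k 0 i) i" if "i < degree f" for i
    using that
  proof (induction i)
    case 0
    then show ?case by (simp add: \<tau>(2) ring_autD(2)[OF \<tau>(1)])
  next
    case (Suc i)
    then have IH: "H (monom 1 i) = monom (twisted_prod \<sigma> k 0 i) i" by simp
    have "H (skew_mult \<sigma> (monom 1 1) (monom 1 i)) = skew_mult \<sigma> (H (monom 1 1)) (H (monom 1 i))"
      using Suc.prems deg by (intro algebra_aut_skew_mult[OF \<sigma> H] dm) (simp_all add: k' IH dp)
    then show ?case
      using twisted_prod_add[OF \<sigma>, of k 1 i]
      by (simp add: k' IH skew_mult_monom_monom[OF \<sigma>] ring_autD(2)[OF \<sigma>] twisted_prod_Suc)
  qed
  have mon: "H (monom c i) = monom (\<tau> c * twisted_prod \<sigma> k 0 i) i" if "i < degree f" for c i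
  proof -
    have "H (skew_mult \<sigma> (monom c 0) (monom 1 i)) = skew_mult \<sigma> (H (monom c 0)) (H (monom 1 i))"
      using that by (intro algebra_aut_skew_mult[OF \<sigma> H] dm) (simp_all add: \<tau>(2) t_pow dp dm)
    then show ?thesis by (simp add: \<tau>(2) t_pow[OF that] skew_mult_monom_monom[OF \<sigma>])
  qed
  have sums: "H (\<Sum>i<n. monom (c i) i) = (\<Sum>i<n. monom (\<tau> (c i) * twisted_prod \<sigma> k 0 i) i)"
    if "n \<le> degree f" for c n
    using that
  proof (induction n)
    case 0
    show ?case using \<tau>(2)[of 0] ring_autD(1)[OF \<tau>(1)] by simp
  next
    case (Suc n)
    have "degree (\<Sum>i<n. monom (c i) i) < degree f"
      using Suc.prems deg
      by (intro degree_lessI) (auto simp: coeff_sum)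
    then show ?case
      using Suc algebra_autD(2)[OF H] dm[of n "c n"] by (simp add: mon)
  qed
  have "H x = twist \<sigma> \<tau> k x" if x: "degree x < degree f" for x
  proof -
    have "H x = (\<Sum>i<degree f. monom (\<tau> (coeff x i) * twisted_prod \<sigma> k 0 i) i)"
      using sums[of "degree f" "coeff x"] by (simp only: poly_eq_sum_monom_lessThan[OF x, symmetric])
    also have "\<dots> = twist \<sigma> \<tau> k x"
      using x by (intro poly_eqI) 
        (auto simp: coeff_sum coeff_twist[OF \<tau>(1)] coeff_eq_0 ring_autD(1)[OF \<tau>(1)])
    finally show ?thesis .
  qed
  moreover have "H_map \<sigma> f \<tau> k = restrict (twist \<sigma> \<tau> k) {g. degree g < degree f}"
    using deg by (subst H_map_eq_twist[OF \<tau>(1)]) (auto simp: petit_simps)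
  ultimately show ?thesis
    using algebra_autD(6)[OF H] by (auto simp: fun_eq_iff extensional_def restrict_def)
qed

text \<open>
  In \<open>S\<^sub>f\<close> the product of \<open>t\<close> and \<open>t\<^bsup>m-1\<^esup>\<close> is \<open>\<Sum> a\<^sub>i t\<^sup>i\<close>; applying the automorphism to both
  sides and comparing coefficients gives the condition on the \<open>a\<^sub>i\<close>.
\<close>

lemma H_map_aut_imp_condition:
  fixes a :: "nat \<Rightarrow> 'a::division_ring" and m :: nat
  defines "f \<equiv> monom 1 m - (\<Sum>i<m. monom (a i) i)"
  assumes \<sigma>: "ring_aut \<sigma>" and m: "m \<ge> 2" and \<tau>: "ring_aut \<tau>" and k: "k \<in> center" "k \<noteq> 0"
    and H: "H_map \<sigma> f \<tau> k \<in> algebra_auts F (petit_algebra \<sigma> f)" and i: "i < m"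
  shows "\<tau> (a i) = twisted_prod \<sigma> k i m * a i"
proof -
  note df = monic_poly_facts(2)[of m a, folded f_def]
  let ?H = "H_map \<sigma> f \<tau> k" and ?P = "twisted_prod \<sigma> k 0"
  define b where "b = (\<Sum>i<m. monom (a i) i)"
  have cb: "coeff b j = (if j < m then a j else 0)" for j by (simp add: b_def coeff_sum)
  have db: "degree b < degree f"
    using m unfolding df by (intro degree_lessI) (auto simp: cb)
  have Ht: "?H x = twist \<sigma> \<tau> k x" if "degree x < degree f" for x
    using m df that by (simp add: H_map_eq_twist[OF \<tau>] petit_simps)
  have tw: "twist \<sigma> \<tau> k (monom 1 j) = monom (?P j) j" for j
    by (auto intro!: poly_eqI simp: coeff_twist[OF \<tau>] ring_autD[OF \<tau>])
  have d: "degree (monom 1 1 :: 'a poly) < degree f" "degree (monom 1 (m - 1) :: 'a poly) < degree f"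
    using m by (simp_all add: df degree_monom_eq)
  have red: "rmod \<sigma> (monom c m) f = skew_mult \<sigma> (monom c 0) b" for c
  proof (rule rmod_eqI[OF \<sigma>])
    show "monom c m = skew_mult \<sigma> (monom c 0) f + skew_mult \<sigma> (monom c 0) b"
      by (simp add: skew_mult_distrib(2)[OF \<sigma>, symmetric] f_def b_def skew_mult_monom_monom[OF \<sigma>])
    show "degree (skew_mult \<sigma> (monom c 0) b) < degree f"
      using degree_skew_mult_le[OF \<sigma>, of "monom c 0" b] db by (simp add: degree_monom_eq)
  qed
  have "skew_mult \<sigma> (monom 1 1) (monom 1 (m - 1)) = monom 1 m"
    using m by (simp add: skew_mult_monom_monom[OF \<sigma>] ring_autD(2)[OF \<sigma>])
  moreover have "skew_mult \<sigma> (monom (?P 1) 1) (monom (?P (m - 1)) (m - 1)) = monom (?P m) m"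
    using m twisted_prod_add[OF \<sigma>, of k 1 "m - 1"] by (simp add: skew_mult_monom_monom[OF \<sigma>])
  ultimately have "?H b = skew_mult \<sigma> (monom (?P m) 0) b"
    using algebra_autD(4)[OF H d] by (simp add: Ht d tw red skew_mult_one[OF \<sigma>] del: One_nat_def)
  then have "coeff (twist \<sigma> \<tau> k b) i = coeff (skew_mult \<sigma> (monom (?P m) 0) b) i"
    by (simp add: Ht db)
  then have "\<tau> (a i) * ?P i = ?P m * a i"
    using i by (simp add: coeff_twist[OF \<tau>] coeff_skew_mult_monom[OF \<sigma>] cb)
  then show ?thesis using twisted_prod_cancel[OF \<sigma> k] i by simp
qed

theorem theorem5p12:
  fixes \<sigma> :: "'a::division_ring \<Rightarrow> 'a" and a :: "nat \<Rightarrow> 'a" and m :: nat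
    and f :: "'a poly" and C F :: "'a set" and S :: "('a, 'a poly) module"
  assumes \<sigma>: "ring_aut \<sigma>" and nontrivial: "\<sigma> \<noteq> id"
    and C: "C = center" and F: "F = C \<inter> Fix \<sigma>"
    and m: "m \<ge> 2"
    and f: "f = monom 1 m - (\<Sum>i<m. monom (a i) i)"
    and S: "S = petit_algebra \<sigma> f"
  shows
    "((\<forall>k \<in> C - {0}. (\<forall>i<m. a i = twisted_prod \<sigma> k i m * a i) \<longrightarrow>
          H_map \<sigma> f id k \<in> algebra_auts F S) \<and>
      subgroup {H_map \<sigma> f id k | k. k \<in> C - {0} \<and> (\<forall>i<m. a i = twisted_prod \<sigma> k i m * a i)}
        (algebra_aut_group F S))
     \<and>
     ((\<forall>\<tau> \<in> Aut_over F. \<forall>k \<in> C - {0}.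
          \<tau> \<circ> \<sigma> = \<sigma> \<circ> \<tau> \<longrightarrow> (\<forall>i<m. \<tau> (a i) = twisted_prod \<sigma> k i m * a i) \<longrightarrow>
          H_map \<sigma> f \<tau> k \<in> algebra_auts F S) \<and>
      subgroup {H_map \<sigma> f \<tau> k | \<tau> k. \<tau> \<in> Aut_over F \<and> \<tau> \<circ> \<sigma> = \<sigma> \<circ> \<tau> \<and> k \<in> C - {0} \<and>
          (\<forall>i<m. \<tau> (a i) = twisted_prod \<sigma> k i m * a i)}
        (algebra_aut_group F S))
     \<and>
     (\<not> right_invariant \<sigma> f \<longrightarrow>
      (\<forall>\<tau> \<in> Aut_over F. \<sigma> \<circ> \<tau> = \<tau> \<circ> \<sigma>) \<longrightarrow>
      restricted_order \<sigma> C = 0 \<or> m - 1 \<le> restricted_order \<sigma> C \<longrightarrow>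
      (\<forall>H \<in> carrier S \<rightarrow>\<^sub>E carrier S.
        H \<in> algebra_auts F S \<longleftrightarrow>
        (\<exists>\<tau> \<in> Aut_over F. \<exists>k \<in> C - {0}.
           (\<forall>i<m. \<tau> (a i) = twisted_prod \<sigma> k i m * a i) \<and> H = H_map \<sigma> f \<tau> k)))"
proof -
  have df: "degree f = m" unfolding f by (rule monic_poly_facts)
  have deg: "degree f > 0" "degree f \<ge> 2" using m df by auto
  have stable: "twist_stable \<sigma> f \<tau> k \<longleftrightarrow> ring_aut \<tau> \<and> \<tau> \<circ> \<sigma> = \<sigma> \<circ> \<tau> \<and> k \<in> C - {0} \<and>
      (\<forall>i<m. \<tau> (a i) = twisted_prod \<sigma> k i m * a i)" for \<tau> k
    unfolding f twist_stable_monic_iff[OF \<sigma>] C by auto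
  have id: "id \<in> Aut_over F" by (simp add: Aut_over_def ring_aut_def bij_id)
  have aut: "H_map \<sigma> f \<tau> k \<in> algebra_auts F S"
    if "\<tau> \<in> Aut_over F" "k \<in> C - {0}" "\<tau> \<circ> \<sigma> = \<sigma> \<circ> \<tau>" "\<forall>i<m. \<tau> (a i) = twisted_prod \<sigma> k i m * a i" for \<tau> k
    unfolding S using that
    by (intro H_map_in_algebra_auts[OF \<sigma> _ deg(1)]) (auto simp: stable Aut_over_def)
  show ?thesis
  proof (intro conjI)
    show "\<forall>k \<in> C - {0}. (\<forall>i<m. a i = twisted_prod \<sigma> k i m * a i) \<longrightarrow> H_map \<sigma> f id k \<in> algebra_auts F S"
      using aut[OF id] by simp
    have "inv_into UNIV (id :: 'a \<Rightarrow> 'a) = id" by (rule inv_id)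
    then have "subgroup {H_map \<sigma> f \<tau> k | \<tau> k. \<tau> \<in> {id} \<and> twist_stable \<sigma> f \<tau> k} (algebra_aut_group F S)"
      unfolding S using id by (intro subgroup_H_maps[OF \<sigma> deg(1)]) auto
    also have "{H_map \<sigma> f \<tau> k | \<tau> k. \<tau> \<in> {id} \<and> twist_stable \<sigma> f \<tau> k}
        = {H_map \<sigma> f id k | k. k \<in> C - {0} \<and> (\<forall>i<m. a i = twisted_prod \<sigma> k i m * a i)}"
      using id unfolding stable by (simp add: Aut_over_def)
    finally show "subgroup {H_map \<sigma> f id k | k. k \<in> C - {0} \<and> (\<forall>i<m. a i = twisted_prod \<sigma> k i m * a i)}
        (algebra_aut_group F S)" .
  next
    show "\<forall>\<tau> \<in> Aut_over F. \<forall>k \<in> C - {0}. \<tau> \<circ> \<sigma> = \<sigma> \<circ> \<tau> \<longrightarrow>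
        (\<forall>i<m. \<tau> (a i) = twisted_prod \<sigma> k i m * a i) \<longrightarrow> H_map \<sigma> f \<tau> k \<in> algebra_auts F S"
      using aut by blast
    let ?T = "{\<tau> \<in> Aut_over F. \<tau> \<circ> \<sigma> = \<sigma> \<circ> \<tau>}"
    have comp: "\<tau> \<circ> \<rho> \<in> ?T" if "\<tau> \<in> ?T" "\<rho> \<in> ?T" for \<tau> \<rho>
    proof -
      have "\<tau> \<circ> \<rho> \<circ> \<sigma> = \<sigma> \<circ> (\<tau> \<circ> \<rho>)" using that by (simp add: fun_eq_iff)
      then show ?thesis using that by (simp add: Aut_over_def ring_aut_comp)
    qed
    have inv: "inv_into UNIV \<tau> \<in> ?T" if "\<tau> \<in> ?T" for \<tau>
    proof -
      have \<tau>: "ring_aut \<tau>" "\<tau> \<circ> \<sigma> = \<sigma> \<circ> \<tau>" "\<And>c. c \<in> F \<Longrightarrow> \<tau> c = c"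
        using that by (auto simp: Aut_over_def)
      have "inv_into UNIV \<tau> c = c" if "c \<in> F" for c
        using ring_aut_inv_into(3)[OF \<tau>(1), of c] \<tau>(3)[OF that] by simp
      moreover have "inv_into UNIV \<tau> \<circ> \<sigma> = \<sigma> \<circ> inv_into UNIV \<tau>"
        using twist_inverse(4)[OF \<sigma> \<tau>(1,2), of 1] by (simp add: center_closed)
      ultimately show ?thesis
        using \<tau>(1) by (simp add: Aut_over_def ring_aut_inv_into(1))
    qed
    have "subgroup {H_map \<sigma> f \<tau> k | \<tau> k. \<tau> \<in> ?T \<and> twist_stable \<sigma> f \<tau> k} (algebra_aut_group F S)"
      unfolding S using id comp inv by (intro subgroup_H_maps[OF \<sigma> deg(1)]) auto
    also have "{H_map \<sigma> f \<tau> k | \<tau> k. \<tau> \<in> ?T \<and> twist_stable \<sigma> f \<tau> k}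
        = {H_map \<sigma> f \<tau> k | \<tau> k. \<tau> \<in> Aut_over F \<and> \<tau> \<circ> \<sigma> = \<sigma> \<circ> \<tau> \<and> k \<in> C - {0} \<and>
          (\<forall>i<m. \<tau> (a i) = twisted_prod \<sigma> k i m * a i)}"
      unfolding stable by (auto simp: Aut_over_def)
    finally show "subgroup {H_map \<sigma> f \<tau> k | \<tau> k. \<tau> \<in> Aut_over F \<and> \<tau> \<circ> \<sigma> = \<sigma> \<circ> \<tau> \<and> k \<in> C - {0} \<and>
          (\<forall>i<m. \<tau> (a i) = twisted_prod \<sigma> k i m * a i)} (algebra_aut_group F S)" .
  next
    show "\<not> right_invariant \<sigma> f \<longrightarrow> (\<forall>\<tau> \<in> Aut_over F. \<sigma> \<circ> \<tau> = \<tau> \<circ> \<sigma>) \<longrightarrow>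
      restricted_order \<sigma> C = 0 \<or> m - 1 \<le> restricted_order \<sigma> C \<longrightarrow>
      (\<forall>H \<in> carrier S \<rightarrow>\<^sub>E carrier S. H \<in> algebra_auts F S \<longleftrightarrow>
        (\<exists>\<tau> \<in> Aut_over F. \<exists>k \<in> C - {0}.
           (\<forall>i<m. \<tau> (a i) = twisted_prod \<sigma> k i m * a i) \<and> H = H_map \<sigma> f \<tau> k))"
    proof (intro impI ballI iffI)
      fix H
      assume ninv: "\<not> right_invariant \<sigma> f" and comm: "\<forall>\<tau> \<in> Aut_over F. \<sigma> \<circ> \<tau> = \<tau> \<circ> \<sigma>"
        and ord: "restricted_order \<sigma> C = 0 \<or> m - 1 \<le> restricted_order \<sigma> C"
        and H: "H \<in> algebra_auts F S"
      obtain \<tau> where \<tau>: "\<tau> \<in> Aut_over F" "\<And>x. H (monom x 0) = monom (\<tau> x) 0"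
        using algebra_aut_restricts_to_constants[OF \<sigma> deg(2) ninv H[unfolded S]] by blast
      then have \<tau>': "ring_aut \<tau>" "\<tau> \<circ> \<sigma> = \<sigma> \<circ> \<tau>" using comm by (auto simp: Aut_over_def)
      \<comment> \<open>For \<open>m = 2\<close> the bound on the order does not exclude \<open>\<sigma> = id\<close> on the center; that the
        inner automorphisms commute with \<open>\<sigma>\<close> does.\<close>
      have "(center :: 'a set) = UNIV"
      proof (rule center_eq_UNIV_if_commutes_with_conjugation[OF \<sigma> nontrivial])
        fix d z :: 'a assume "d \<noteq> 0"
        then have "(\<lambda>z. d * z * inverse d) \<in> Aut_over F"
          by (rule conjugation_in_Aut_over) (simp add: F C)
        then have "\<sigma> \<circ> (\<lambda>z. d * z * inverse d) = (\<lambda>z. d * z * inverse d) \<circ> \<sigma>"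
          using comm by blast
        from fun_cong[OF this, of z] show "\<sigma> (d * z * inverse d) = d * \<sigma> z * inverse d"
          by simp
      qed
      then have "\<exists>c\<in>center. \<sigma> c \<noteq> c" using nontrivial by auto
      then obtain k where k: "k \<in> center" "k \<noteq> 0" "H (monom 1 1) = monom k 1"
        using algebra_aut_image_of_t[OF \<sigma> deg(2) H[unfolded S] \<tau>' \<tau>(2)] ord df C by auto
      have eq: "H = H_map \<sigma> f \<tau> k"
        by (rule algebra_aut_eq_H_map[OF \<sigma> deg(2) H[unfolded S] \<tau>'(1) \<tau>(2) k(3)])
      have "\<tau> (a i) = twisted_prod \<sigma> k i m * a i" if "i < m" for i
        using H_map_aut_imp_condition[OF \<sigma> m \<tau>'(1) k(1,2) _ that] H eq unfolding S f by simp
      then show "\<exists>\<tau> \<in> Aut_over F. \<exists>k \<in> C - {0}.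
           (\<forall>i<m. \<tau> (a i) = twisted_prod \<sigma> k i m * a i) \<and> H = H_map \<sigma> f \<tau> k"
        using \<tau>(1) k(1,2) eq C by blast
    next
      fix H
      assume "\<forall>\<tau> \<in> Aut_over F. \<sigma> \<circ> \<tau> = \<tau> \<circ> \<sigma>"
        and "\<exists>\<tau> \<in> Aut_over F. \<exists>k \<in> C - {0}.
           (\<forall>i<m. \<tau> (a i) = twisted_prod \<sigma> k i m * a i) \<and> H = H_map \<sigma> f \<tau> k"
      then show "H \<in> algebra_auts F S" using aut by (metis)
    qed
  qed
qed

end
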